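(* Let $L\ge1$, $m\ge 2$, and define $$K^m_{\ell_\infty}=\{(\mathbf{X}_1,\ldots,\mathbf{X}_m)\in\mathbb{S}^L_+\times(\mathbb{R}^{L\times L})^{m-1} : (\mathbf{X}_1,\mathbf{X}_i)\in K^2_{\ell_2}\ \ \forall i\in\{2,\ldots,m\}\},$$ where $K^2_{\ell_2}=\operatorname{cl}\{(\mathbf{X},\mathbf{Y})\in\mathbb{S}^L_{++}\times\mathbb{R}^{L\times L}:\mathbf{X}-\mathbf{Y}\mathbf{X}^{-1}\mathbf{Y}^\top\succ 0\}$. Then $$\hat F(\mathbf{X}_1,\ldots,\mathbf{X}_m)=-\sum_{i=2}^m\log\det\big(\mathbf{X}_1-\mathbf{X}_i\mathbf{X}_1^{-1}\mathbf{X}_i^\top\big)-\log\det\mathbf{X}_1,$$ defined where all these matrices are positive definite, is an $Lm$-self-concordant barrier for $K^m_{\ell_\infty}$.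
   Context: $\mathbb{S}^L$, $\mathbb{S}^L_+$, $\mathbb{S}^L_{++}$ denote the real symmetric, positive semidefinite and positive definite $L\times L$ matrices. A function $F$ on the interior of a closed convex set $K$ with nonempty interior is a $\nu$-self-concordant barrier if it is $C^3$ and convex, $F(\mathbf{x}_k)\to\infty$ whenever $\mathbf{x}_k$ converges to a boundary point of $K$, and for all interior $\mathbf{x}$ and directions $\mathbf{h}$: $|D^3F(\mathbf{x})[\mathbf{h},\mathbf{h},\mathbf{h}]|\le 2(D^2F(\mathbf{x})[\mathbf{h},\mathbf{h}])^{3/2}$ and $(DF(\mathbf{x})[\mathbf{h}])^2\le\nu\, D^2F(\mathbf{x})[\mathbf{h},\mathbf{h}]$. *)

theory Defs
  imports "HOL-Analysis.Analysis"
begin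

definition sym_mat :: "real^'n^'n \<Rightarrow> bool" where
  "sym_mat A \<longleftrightarrow> transpose A = A"

definition psd_mat :: "real^'n^'n \<Rightarrow> bool" where
  "psd_mat A \<longleftrightarrow> sym_mat A \<and> (\<forall>x. 0 \<le> x \<bullet> (A *v x))"

definition pd_mat :: "real^'n^'n \<Rightarrow> bool" where
  "pd_mat A \<longleftrightarrow> sym_mat A \<and> (\<forall>x. x \<noteq> 0 \<longrightarrow> 0 < x \<bullet> (A *v x))"

definition K2_l2 :: "((real^'n^'n) \<times> (real^'n^'n)) set" where
  "K2_l2 = closure {(X, Y). pd_mat X \<and> pd_mat (X - Y ** matrix_inv X ** transpose Y)}"

text \<open>The cone K^m_{l_infinity}: a point (X_1, X_2, ..., X_m) is represented as a pair
  (X_1, Y) with Y indexed by a finite type 'k of cardinality m - 1.\<close>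

definition Km_linf :: "((real^'n^'n) \<times> (real^'n^'n^'k)) set" where
  "Km_linf = {(X1, Y). psd_mat X1 \<and> (\<forall>i. (X1, Y $ i) \<in> K2_l2)}"

definition amb_space :: "((real^'n^'n) \<times> (real^'n^'n^'k)) set" where
  "amb_space = {(X1, Y). sym_mat X1}"

definition Fhat_dom :: "((real^'n^'n) \<times> (real^'n^'n^'k)) set" where
  "Fhat_dom = {(X1, Y). pd_mat X1 \<and>
      (\<forall>i. pd_mat (X1 - (Y $ i) ** matrix_inv X1 ** transpose (Y $ i)))}"

definition Fhat :: "(real^'n^'n) \<times> (real^'n^'n^'k) \<Rightarrow> real" where
  "Fhat p = (case p of (X1, Y) \<Rightarrow>
      - (\<Sum>i\<in>UNIV. ln (det (X1 - (Y $ i) ** matrix_inv X1 ** transpose (Y $ i))))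
      - ln (det X1))"

definition interior_in :: "'a::real_normed_vector set \<Rightarrow> 'a set \<Rightarrow> 'a set" where
  "interior_in V K = {x. \<exists>T. openin (top_of_set V) T \<and> x \<in> T \<and> T \<subseteq> K}"

definition sc_barrier ::
  "'a::euclidean_space set \<Rightarrow> 'a set \<Rightarrow> 'a set \<Rightarrow> ('a \<Rightarrow> real) \<Rightarrow> real \<Rightarrow> bool" where
  "sc_barrier V K U F \<nu> \<longleftrightarrow>
     subspace V \<and> K \<subseteq> V \<and> closed K \<and> convex K \<and>
     U = interior_in V K \<and> U \<noteq> {} \<and>
     convex_on U F \<and>
     (\<exists>(D1 :: 'a \<Rightarrow> ('a \<Rightarrow>\<^sub>L real)) (D2 :: 'a \<Rightarrow> ('a \<Rightarrow>\<^sub>L ('a \<Rightarrow>\<^sub>L real)))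
        (D3 :: 'a \<Rightarrow> ('a \<Rightarrow>\<^sub>L ('a \<Rightarrow>\<^sub>L ('a \<Rightarrow>\<^sub>L real)))).
        (\<forall>x\<in>U. (F has_derivative blinfun_apply (D1 x)) (at x within U) \<and>
                (D1 has_derivative blinfun_apply (D2 x)) (at x within U) \<and>
                (D2 has_derivative blinfun_apply (D3 x)) (at x within U)) \<and>
        continuous_on U D3 \<and>
        (\<forall>x\<in>U. \<forall>h\<in>V.
           \<bar>D3 x h h h\<bar> \<le> 2 * (D2 x h h) powr (3/2) \<and>
           (D1 x h)\<^sup>2 \<le> \<nu> * D2 x h h)) \<and>
     (\<forall>(xs :: nat \<Rightarrow> 'a) p. (\<forall>k. xs k \<in> U) \<longrightarrow> xs \<longlonglongrightarrow> p \<longrightarrow> p \<in> K - U \<longrightarrow>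
         filterlim (\<lambda>k. F (xs k)) at_top sequentially)"

end

theory Submission
  imports Defs
begin

text \<open>
  Write \<open>S = X - Y X\<^sup>-\<^sup>1 Y\<^sup>T\<close> for a Schur complement and differentiate along a line with
  direction \<open>(H, V)\<close>. With \<open>W = V - Y X\<^sup>-\<^sup>1 H\<close> one finds \<open>S'' = - 2 W X\<^sup>-\<^sup>1 W\<^sup>T\<close> and
  \<open>S''' = 6 W X\<^sup>-\<^sup>1 H X\<^sup>-\<^sup>1 W\<^sup>T\<close>. Normalising \<open>X\<close> and \<open>S\<close> to the identity by congruences, the
  Cauchy-Schwarz inequality and submultiplicativity of the Frobenius norm bound the derivatives of
  \<open>F\<close> by \<open>F'' = a\<^sup>2 + g\<^sup>2 + 2 b\<close> and \<open>|F'''| \<le> 2 (a\<^sup>3 + g\<^sup>3 + 3 a b + 3 g b)\<close>, where \<open>g\<close> is the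
  norm of the normalised \<open>H\<close>, \<open>a\<^sup>2\<close> is the sum of the squared norms of the normalised \<open>S'\<close>, and
  \<open>b\<close> that of the normalised \<open>W\<close>; self-concordance is then a scalar inequality. The parameter is
  the Cauchy-Schwarz constant for the sum of the \<open>m\<close> traces of \<open>L \<times> L\<close> matrices in \<open>F'\<close>.
  The cone is described by positive semidefiniteness of the block matrices with rows
  \<open>(X, Y)\<close> and \<open>(Y\<^sup>T, X)\<close>.
\<close>

subsection \<open>Matrix calculus\<close>

lemma matrix_inv_works:
  fixes A :: "real^'n^'n"
  assumes "det A \<noteq> 0"
  shows "A ** matrix_inv A = mat 1" "matrix_inv A ** A = mat 1"
proof -
  have "\<exists>B. A ** B = mat 1 \<and> B ** A = mat 1"
    using assms by (simp add: invertible_det_nz[symmetric] invertible_def)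
  then have "A ** matrix_inv A = mat 1 \<and> matrix_inv A ** A = mat 1"
    unfolding matrix_inv_def by (rule someI_ex)
  then show "A ** matrix_inv A = mat 1" "matrix_inv A ** A = mat 1" by auto
qed

lemma matrix_inv_eqI:
  fixes A B :: "real^'n^'n"
  assumes "A ** B = mat 1"
  shows "matrix_inv A = B"
proof -
  have "det A * det B = 1"
    by (metis assms det_mul det_I)
  then have "det A \<noteq> 0" by auto
  then show ?thesis
    by (metis assms matrix_inv_works(2) matrix_mul_assoc matrix_mul_lid matrix_mul_rid)
qed

lemma transpose_add: "transpose (A + B) = transpose A + transpose (B :: real^'n^'m)"
  by (simp add: transpose_def vec_eq_iff)

lemma transpose_diff: "transpose (A - B) = transpose A - transpose (B :: real^'n^'m)"
  by (simp add: transpose_def vec_eq_iff)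

lemma transpose_minus: "transpose (- A) = - transpose (A :: real^'n^'m)"
  by (simp add: transpose_def vec_eq_iff)

section \<open>The Frobenius inner product and norm\<close>

lemma norm_transpose: "norm (transpose A) = norm (A :: real^'n^'m)"
proof -
  have "transpose A \<bullet> transpose A = A \<bullet> A"
    unfolding inner_vec_def transpose_def by (simp add: sum.swap[of _ "UNIV::'n set"])
  then show ?thesis by (simp add: norm_eq_sqrt_inner)
qed

text \<open>Identifies the inner product of vectors of rows as the Frobenius one. So
  \<open>norm\<close> of a matrix is the Frobenius norm throughout, and Cauchy-Schwarz becomes a
  bound on traces.\<close>

lemma inner_matrix_eq_trace: "A \<bullet> B = trace (transpose A ** (B :: real^'n^'m))"
  unfolding inner_vec_def trace_def matrix_matrix_mult_def transpose_def
  by (simp add: sum.swap[of _ "UNIV::'n set"])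

lemma norm_matrix_vector_le: "norm (A *v x) \<le> norm (A :: real^'n^'m) * norm x"
proof -
  have "norm (A *v x) = L2_set (\<lambda>i. \<bar>A $ i \<bullet> x\<bar>) UNIV"
    by (simp add: norm_vec_def matrix_vector_mul_component)
  also have "\<dots> \<le> L2_set (\<lambda>i. norm (A $ i) * norm x) UNIV"
    by (intro L2_set_mono Cauchy_Schwarz_ineq2) auto
  also have "\<dots> = norm A * norm x"
    by (simp add: norm_vec_def[of A] L2_set_left_distrib)
  finally show ?thesis .
qed

text \<open>Row \<open>i\<close> of the product is the transpose of \<open>B\<close> applied to row
  \<open>i\<close> of \<open>A\<close>, so the matrix-vector bound applies row by row.\<close>

lemma norm_matrix_mult_le:
  "norm (A ** B) \<le> norm (A :: real^'n^'m) * norm (B :: real^'p^'n)"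
proof -
  have row: "(A ** B) $ i = transpose B *v (A $ i)" for i
    by (simp add: vec_eq_iff matrix_matrix_mult_def matrix_vector_mult_def transpose_def mult.commute)
  have "norm (A ** B) = L2_set (\<lambda>i. norm (transpose B *v (A $ i))) UNIV"
    by (simp add: norm_vec_def[of "A ** B"] row del: transpose_matrix_vector)
  also have "\<dots> \<le> L2_set (\<lambda>i. norm (transpose B) * norm (A $ i)) UNIV"
    by (intro L2_set_mono norm_matrix_vector_le) auto
  also have "\<dots> = norm A * norm B"
    by (simp add: norm_vec_def[of A] L2_set_right_distrib[symmetric] norm_transpose mult.commute)
  finally show ?thesis .
qed

text \<open>Makes the general theory of bounded bilinear maps available for the matrix product:
  distributive laws, limits and the product rule.\<close>

lemma bounded_bilinear_matrix_mult:
  "bounded_bilinear ((**) :: real^'n^'m \<Rightarrow> real^'p^'n \<Rightarrow> real^'p^'m)"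
proof
  show "\<exists>K. \<forall>A B. norm ((A :: real^'n^'m) ** (B :: real^'p^'n)) \<le> norm A * norm B * K"
    by (rule exI[of _ 1]) (simp add: norm_matrix_mult_le)
qed (simp_all add: matrix_matrix_mult_def vec_eq_iff sum.distrib[symmetric] scaleR_sum_right
    algebra_simps scalar_matrix_assoc sum_distrib_left)

lemmas matrix_mult_simps =
  bounded_bilinear.add_left[OF bounded_bilinear_matrix_mult]
  bounded_bilinear.add_right[OF bounded_bilinear_matrix_mult]
  bounded_bilinear.diff_left[OF bounded_bilinear_matrix_mult]
  bounded_bilinear.diff_right[OF bounded_bilinear_matrix_mult]
  bounded_bilinear.minus_left[OF bounded_bilinear_matrix_mult]
  bounded_bilinear.minus_right[OF bounded_bilinear_matrix_mult]
  bounded_bilinear.scaleR_left[OF bounded_bilinear_matrix_mult]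
  bounded_bilinear.scaleR_right[OF bounded_bilinear_matrix_mult]

lemma bounded_linear_trace: "bounded_linear (trace :: real^'n^'n \<Rightarrow> real)"
proof -
  have "trace = (\<lambda>A :: real^'n^'n. mat 1 \<bullet> A)"
    by (simp add: inner_matrix_eq_trace fun_eq_iff)
  then show ?thesis by (metis bounded_linear_inner_right)
qed

lemma bounded_linear_transpose: "bounded_linear (transpose :: real^'n^'m \<Rightarrow> real^'m^'n)"
proof
  show "\<exists>K. \<forall>A. norm (transpose (A :: real^'n^'m)) \<le> norm A * K"
    by (rule exI[of _ 1]) (simp add: norm_transpose)
qed (auto simp: transpose_add transpose_scalar)

lemma norm_sq_mat_one: "(norm (mat 1 :: real^'n^'n))\<^sup>2 = real CARD('n)"
  by (simp add: power2_norm_eq_inner inner_matrix_eq_trace trace_I)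

text \<open>Cauchy-Schwarz against the identity, whose squared Frobenius norm is the dimension. The
  factor L of the barrier parameter originates here.\<close>

lemma trace_sq_le: "(trace A)\<^sup>2 \<le> real CARD('n) * (norm (A :: real^'n^'n))\<^sup>2"
proof -
  have "(trace A)\<^sup>2 = (mat 1 \<bullet> A)\<^sup>2"
    by (simp add: inner_matrix_eq_trace)
  also have "\<dots> \<le> (mat 1 \<bullet> (mat 1 :: real^'n^'n)) * (A \<bullet> A)"
    by (rule Cauchy_Schwarz_ineq)
  finally show ?thesis by (simp add: norm_sq_mat_one[symmetric] power2_norm_eq_inner)
qed

section \<open>Continuity and derivatives of the determinant and the inverse\<close>

lemma continuous_on_det: "continuous_on S (det :: real^'n^'n \<Rightarrow> real)"
  unfolding det_def by (intro continuous_intros)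

text \<open>Column \<open>l\<close> of the inverse solves the linear system whose right-hand side is
  column \<open>l\<close> of the identity. Writing the entries as quotients of determinants reduces
  continuity of the inverse to continuity of \<open>det\<close>.\<close>

lemma matrix_inv_cramer:
  fixes A :: "real^'n^'n"
  assumes "det A \<noteq> 0"
  shows "matrix_inv A =
    (\<chi> k l. det (\<chi> i j. if j = k then mat 1 $ i $ l else A $ i $ j) / det A)"
proof -
  have "matrix_inv A $ k $ l = det (\<chi> i j. if j = k then mat 1 $ i $ l else A $ i $ j) / det A" for k l
  proof -
    have "A *v column l (matrix_inv A) = column l (mat 1)"
      by (metis assms matrix_inv_works(1) matrix_vector_mul_assoc matrix_vector_mult_basis)
    then have "column l (matrix_inv A)
        = (\<chi> k. det (\<chi> i j. if j = k then column l (mat 1) $ i else A $ i $ j) / det A)"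
      using cramer[OF assms] by blast
    then have "column l (matrix_inv A) $ k
        = det (\<chi> i j. if j = k then column l (mat 1) $ i else A $ i $ j) / det A"
      by simp
    moreover have "column l (mat 1) $ i = (mat 1 :: real^'n^'n) $ i $ l" for i
      by (simp add: column_def)
    ultimately show ?thesis by (simp add: column_def[of l "matrix_inv A"] cong: if_cong)
  qed
  then show ?thesis by (simp add: vec_eq_iff)
qed

lemma continuous_on_matrix_inv:
  "continuous_on {A :: real^'n^'n. det A \<noteq> 0} matrix_inv"
proof -
  have "continuous_on {A :: real^'n^'n. det A \<noteq> 0}
     (\<lambda>A. \<chi> k l. det (\<chi> i j. if j = k then mat 1 $ i $ l else A $ i $ j) / det A)"
  proof (intro continuous_on_vec_lambda continuous_on_divide continuous_on_det)
    fix k l :: 'n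
    have "continuous_on {A :: real^'n^'n. det A \<noteq> 0}
        (\<lambda>A. if j = k then mat 1 $ i $ l else A $ i $ j :: real)" for i j
      by (cases "j = k") (auto intro!: continuous_intros)
    then show "continuous_on {A :: real^'n^'n. det A \<noteq> 0}
        (\<lambda>A. det (\<chi> i j. if j = k then mat 1 $ i $ l else A $ i $ j))"
      by (intro continuous_on_compose2[OF continuous_on_det[of UNIV]] continuous_on_vec_lambda) auto
  qed auto
  then show ?thesis
    by (rule continuous_on_eq) (simp add: matrix_inv_cramer)
qed

lemma open_det_nonzero: "open {A :: real^'n^'n. det A \<noteq> 0}"
  by (intro open_Collect_neq continuous_on_det continuous_on_const)

lemma isCont_matrix_inv: "det (A :: real^'n^'n) \<noteq> 0 \<Longrightarrow> isCont matrix_inv A"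
  using continuous_on_matrix_inv open_det_nonzero
  by (metis (mono_tags, lifting) continuous_on_eq_continuous_at mem_Collect_eq)

text \<open>The resolvent identity, obtained by expanding the product on the right.\<close>

lemma matrix_inv_diff:
  fixes A B :: "real^'n^'n"
  assumes "det A \<noteq> 0" "det B \<noteq> 0"
  shows "matrix_inv B - matrix_inv A = - (matrix_inv B ** (B - A) ** matrix_inv A)"
proof -
  have "matrix_inv B ** (B - A) ** matrix_inv A
     = (matrix_inv B ** B) ** matrix_inv A - matrix_inv B ** (A ** matrix_inv A)"
    by (simp only: matrix_mult_simps matrix_mul_assoc)
  then show ?thesis by (simp add: matrix_inv_works assms)
qed

text \<open>By the resolvent identity the remainder is minus the product of
  \<open>matrix_inv B - matrix_inv A\<close>, \<open>B - A\<close> and \<open>matrix_inv A\<close>.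
  Divided by \<open>norm (B - A)\<close> it tends to 0 because the inverse is continuous.\<close>

lemma has_derivative_matrix_inv:
  fixes A :: "real^'n^'n"
  assumes A: "det A \<noteq> 0"
  shows "(matrix_inv has_derivative (\<lambda>H. - (matrix_inv A ** H ** matrix_inv A))) (at A)"
proof -
  obtain e where e: "e > 0" "\<And>B. dist B A < e \<Longrightarrow> det B \<noteq> 0"
    using open_det_nonzero A unfolding open_dist by blast
  show ?thesis
  proof (rule has_derivativeI_sandwich[OF e(1)])
    show "bounded_linear (\<lambda>H. - (matrix_inv A ** H ** matrix_inv A))"
      by (intro bounded_linear_minus
          bounded_linear_compose[OF bounded_bilinear.bounded_linear_left[OF bounded_bilinear_matrix_mult]
             bounded_bilinear.bounded_linear_right[OF bounded_bilinear_matrix_mult]])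
    have "(matrix_inv \<longlongrightarrow> matrix_inv A) (at A)"
      using isCont_matrix_inv[OF A] by (simp add: isCont_def)
    then show "((\<lambda>B. norm (matrix_inv B - matrix_inv A) * norm (matrix_inv A)) \<longlongrightarrow> 0) (at A)"
      by (simp add: LIM_zero_iff tendsto_mult_left_zero tendsto_norm_zero)
  next
    fix B :: "real^'n^'n" assume B: "B \<noteq> A" "dist B A < e"
    have "matrix_inv B - matrix_inv A - - (matrix_inv A ** (B - A) ** matrix_inv A)
        = - ((matrix_inv B - matrix_inv A) ** (B - A) ** matrix_inv A)"
      unfolding matrix_mult_simps(3) using matrix_inv_diff[OF A e(2)[OF B(2)]] by simp
    also have "norm \<dots> \<le> norm (matrix_inv B - matrix_inv A) * norm (B - A) * norm (matrix_inv A)"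
      unfolding norm_minus_cancel
      by (meson mult_right_mono norm_ge_zero norm_matrix_mult_le order_trans)
    finally show "norm (matrix_inv B - matrix_inv A - - (matrix_inv A ** (B - A) ** matrix_inv A)) / norm (B - A)
        \<le> norm (matrix_inv B - matrix_inv A) * norm (matrix_inv A)"
      using B(1) by (simp add: field_simps)
  qed
qed

text \<open>Differentiating the Leibniz formula leaves products with one factor removed. A
  permutation other than the identity moves at least two points, so an off-diagonal zero of
  \<open>mat 1\<close> survives in each of its products. Only the identity permutation contributes,
  and it gives the trace.\<close>

lemma has_derivative_det_mat_one:
  "((det :: real^'n^'n \<Rightarrow> real) has_derivative trace) (at (mat 1))"
proof -
  let ?P = "{p. p permutes (UNIV::'n set)}"
  have "((\<lambda>A :: real^'n^'n. \<Sum>p\<in>?P. of_int (sign p) * (\<Prod>i\<in>UNIV. A $ i $ p i)) has_derivative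
     (\<lambda>H. \<Sum>p\<in>?P. of_int (sign p) * (\<Sum>i\<in>UNIV. H $ i $ p i * (\<Prod>j\<in>UNIV - {i}. mat 1 $ j $ p j))))
     (at (mat 1))"
    by (intro has_derivative_sum has_derivative_mult_right has_derivative_prod
        bounded_linear_imp_has_derivative
        bounded_linear_compose[OF bounded_linear_vec_nth bounded_linear_vec_nth])
  moreover have "(\<Sum>p\<in>?P. of_int (sign p) * (\<Sum>i\<in>UNIV. H $ i $ p i * (\<Prod>j\<in>UNIV - {i}. mat 1 $ j $ p j)))
     = trace H" for H :: "real^'n^'n"
  proof -
    have zero: "(\<Prod>j\<in>UNIV - {i}. mat 1 $ j $ p j) = (0::real)" if p: "p \<in> ?P - {id}" for p and i :: 'n
    proof -
      have "\<exists>j. j \<noteq> i \<and> p j \<noteq> j"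
      proof (rule ccontr)
        assume "\<not> ?thesis"
        then have fix_j: "\<And>j. j \<noteq> i \<Longrightarrow> p j = j" by blast
        have "inj p" using p permutes_inj by auto
        then have "p i = i" by (metis fix_j injD)
        then have "p = id" using fix_j by (metis eq_id_iff)
        then show False using p by simp
      qed
      then obtain j where "j \<noteq> i" "p j \<noteq> j" by blast
      then show ?thesis by (intro prod_zero) (auto simp: mat_def intro!: bexI[of _ j])
    qed
    have "(\<Sum>p\<in>?P. of_int (sign p) * (\<Sum>i\<in>UNIV. H $ i $ p i * (\<Prod>j\<in>UNIV - {i}. mat 1 $ j $ p j)))
       = (\<Sum>p\<in>{id}. of_int (sign p) * (\<Sum>i\<in>UNIV. H $ i $ p i * (\<Prod>j\<in>UNIV - {i}. mat 1 $ j $ p j)))"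
      by (rule sum.mono_neutral_right) (auto simp: permutes_id zero)
    also have "\<dots> = trace H" by (simp add: trace_def mat_def sign_id)
    finally show ?thesis .
  qed
  ultimately show ?thesis unfolding det_def[abs_def] by (simp add: o_def)
qed

text \<open>The factorisation \<open>det B = det A * det (matrix_inv A ** B)\<close> transports the
  derivative at the identity to \<open>A\<close>.\<close>

lemma has_derivative_ln_det:
  fixes A :: "real^'n^'n"
  assumes A: "det A > 0"
  shows "((\<lambda>B. ln (det B)) has_derivative (\<lambda>H. trace (matrix_inv A ** H))) (at A)"
proof -
  have A0: "det A \<noteq> 0" using A by simp
  have lin: "bounded_linear (\<lambda>B. matrix_inv A ** B)"
    by (rule bounded_bilinear.bounded_linear_right[OF bounded_bilinear_matrix_mult])
  have one: "(det has_derivative trace) (at (matrix_inv A ** A))"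
    using has_derivative_det_mat_one by (simp add: matrix_inv_works A0)
  have "((\<lambda>B. det (matrix_inv A ** B)) has_derivative (\<lambda>H. trace (matrix_inv A ** H))) (at A)"
    using has_derivative_compose[OF bounded_linear_imp_has_derivative[OF lin] one] .
  then have "((\<lambda>B. det A * det (matrix_inv A ** B)) has_derivative
      (\<lambda>H. det A * trace (matrix_inv A ** H))) (at A)"
    by (rule has_derivative_mult_right)
  moreover have "det A * det (matrix_inv A ** B) = det B" for B
    by (metis A0 det_mul matrix_inv_works(1) matrix_mul_assoc matrix_mul_lid)
  ultimately have "(det has_derivative (\<lambda>H. det A * trace (matrix_inv A ** H))) (at A)"
    by simp
  from has_derivative_ln[OF A this] show ?thesis
    using A by (simp add: field_simps)
qed

subsection \<open>Functions of class \<open>C\<^sup>n\<close> on a set\<close>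

text \<open>Derivatives are tested in fixed directions \<open>v\<close>, so the recursion stays at
  one function type instead of passing to operator-valued maps. They are taken within
  \<open>S\<close> because the domain of the barrier is open only relative to the subspace
  \<open>amb_space\<close>.\<close>

primrec smooth_on :: "nat \<Rightarrow> ('a::real_normed_vector \<Rightarrow> 'b::real_normed_vector) \<Rightarrow> 'a set \<Rightarrow> bool" where
  "smooth_on 0 f S \<longleftrightarrow> continuous_on S f"
| "smooth_on (Suc n) f S \<longleftrightarrow>
     (\<exists>f'. (\<forall>x\<in>S. (f has_derivative f' x) (at x within S)) \<and> (\<forall>v. smooth_on n (\<lambda>x. f' x v) S))"

lemma smooth_on_SucI:
  assumes "\<And>x. x \<in> S \<Longrightarrow> (f has_derivative f' x) (at x within S)"
    and "\<And>v. smooth_on n (\<lambda>x. f' x v) S"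
  shows "smooth_on (Suc n) f S"
  using assms by auto

lemma smooth_on_SucE:
  assumes "smooth_on (Suc n) f S"
  obtains f' where "\<And>x. x \<in> S \<Longrightarrow> (f has_derivative f' x) (at x within S)"
    "\<And>v. smooth_on n (\<lambda>x. f' x v) S"
  using assms by auto

lemma smooth_on_SucD: "smooth_on (Suc n) f S \<Longrightarrow> smooth_on n f S"
proof (induction n arbitrary: f)
  case 0
  then show ?case
    by (auto simp: continuous_on_eq_continuous_within intro: has_derivative_continuous)
next
  case (Suc n)
  obtain f' where f': "\<And>x. x \<in> S \<Longrightarrow> (f has_derivative f' x) (at x within S)"
      "\<And>v. smooth_on (Suc n) (\<lambda>x. f' x v) S"
    using Suc.prems by (rule smooth_on_SucE) blast
  show ?case by (rule smooth_on_SucI[OF f'(1) Suc.IH[OF f'(2)]])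
qed

lemma smooth_on_cong:
  assumes "\<And>x. x \<in> S \<Longrightarrow> f x = g x" "smooth_on n f S"
  shows "smooth_on n g S"
proof (cases n)
  case 0
  then show ?thesis using assms by (simp cong: continuous_on_cong)
next
  case (Suc m)
  then obtain f' where f': "\<And>x. x \<in> S \<Longrightarrow> (f has_derivative f' x) (at x within S)"
      "\<And>v. smooth_on m (\<lambda>x. f' x v) S"
    using assms(2) smooth_on_SucE by metis
  have "(g has_derivative f' x) (at x within S)" if "x \<in> S" for x
    using has_derivative_transform[OF that _ f'(1)[OF that]] assms(1) by metis
  then show ?thesis using f'(2) Suc by auto
qed

lemma smooth_on_const: "smooth_on n (\<lambda>x. c) S"
proof (induction n arbitrary: c)
  case (Suc n)
  show ?case by (auto intro!: exI[of _ "\<lambda>x h. 0"] Suc)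
qed simp

lemma smooth_on_bounded_linear:
  assumes L: "bounded_linear L" and "smooth_on n f S"
  shows "smooth_on n (\<lambda>x. L (f x)) S"
  using assms(2)
proof (induction n arbitrary: f)
  case 0
  then show ?case using bounded_linear.continuous_on[OF L] by auto
next
  case (Suc n)
  then obtain f' where f': "\<forall>x\<in>S. (f has_derivative f' x) (at x within S)"
      "\<forall>v. smooth_on n (\<lambda>x. f' x v) S"
    by auto
  then show ?case
    by (auto intro!: exI[of _ "\<lambda>x h. L (f' x h)"] bounded_linear.has_derivative[OF L] Suc.IH)
qed

lemma smooth_on_id: "smooth_on n (\<lambda>x. x) S"
proof (cases n)
  case (Suc m)
  then show ?thesis by (auto intro!: exI[of _ "\<lambda>x h. h"] smooth_on_const)
qed simp

lemma smooth_on_add: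
  "smooth_on n f S \<Longrightarrow> smooth_on n g S \<Longrightarrow> smooth_on n (\<lambda>x. f x + g x) S"
proof (induction n arbitrary: f g)
  case 0
  then show ?case by (simp add: continuous_on_add)
next
  case (Suc n)
  from Suc.prems(1) obtain f' where f': "\<forall>x\<in>S. (f has_derivative f' x) (at x within S)"
      "\<forall>v. smooth_on n (\<lambda>x. f' x v) S"
    by auto
  from Suc.prems(2) obtain g' where g': "\<forall>x\<in>S. (g has_derivative g' x) (at x within S)"
      "\<forall>v. smooth_on n (\<lambda>x. g' x v) S"
    by auto
  show ?case
    by (rule smooth_on_SucI[of _ _ "\<lambda>x h. f' x h + g' x h"])
      (use f' g' in \<open>simp_all add: has_derivative_add Suc.IH\<close>)
qed

lemma smooth_on_minus: "smooth_on n f S \<Longrightarrow> smooth_on n (\<lambda>x. - f x) S"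
  by (rule smooth_on_bounded_linear[OF bounded_linear_minus[OF bounded_linear_ident]])

lemma smooth_on_diff:
  "smooth_on n f S \<Longrightarrow> smooth_on n g S \<Longrightarrow> smooth_on n (\<lambda>x. f x - g x) S"
  using smooth_on_add[OF _ smooth_on_minus, of n f S g] by simp

lemma smooth_on_sum:
  assumes "finite I" "\<And>i. i \<in> I \<Longrightarrow> smooth_on n (f i) S"
  shows "smooth_on n (\<lambda>x. \<Sum>i\<in>I. f i x) S"
  using assms by (induction I rule: finite_induct) (auto intro: smooth_on_const smooth_on_add)

lemma smooth_on_bilinear:
  assumes B: "bounded_bilinear B"
  shows "smooth_on n f S \<Longrightarrow> smooth_on n g S \<Longrightarrow> smooth_on n (\<lambda>x. B (f x) (g x)) S"
proof (induction n arbitrary: f g)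
  case 0
  then show ?case using bounded_bilinear.continuous_on[OF B] by auto
next
  case (Suc n)
  from Suc.prems(1) obtain f' where f': "\<forall>x\<in>S. (f has_derivative f' x) (at x within S)"
      "\<forall>v. smooth_on n (\<lambda>x. f' x v) S"
    by auto
  from Suc.prems(2) obtain g' where g': "\<forall>x\<in>S. (g has_derivative g' x) (at x within S)"
      "\<forall>v. smooth_on n (\<lambda>x. g' x v) S"
    by auto
  show ?case
  proof (rule smooth_on_SucI)
    show "((\<lambda>x. B (f x) (g x)) has_derivative (\<lambda>h. B (f x) (g' x h) + B (f' x h) (g x)))
        (at x within S)" if "x \<in> S" for x
      using bounded_bilinear.FDERIV[OF B] f'(1) g'(1) that by blast
    show "smooth_on n (\<lambda>x. B (f x) (g' x v) + B (f' x v) (g x)) S" for v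
      using f'(2) g'(2) smooth_on_SucD[OF Suc.prems(1)] smooth_on_SucD[OF Suc.prems(2)]
      by (intro smooth_on_add Suc.IH) auto
  qed
qed

lemmas smooth_on_matrix_mult = smooth_on_bilinear[OF bounded_bilinear_matrix_mult]

text \<open>The derivative of the inverse again contains the inverse, but only its smoothness of one
  order less is required there, so induction on the order closes.\<close>

lemma smooth_on_matrix_inv:
  fixes M :: "'a::real_normed_vector \<Rightarrow> real^'n^'n"
  assumes "smooth_on n M S" and nz: "\<And>x. x \<in> S \<Longrightarrow> det (M x) \<noteq> 0"
  shows "smooth_on n (\<lambda>x. matrix_inv (M x)) S"
  using assms(1)
proof (induction n)
  case 0
  then show ?case
    using nz by (auto intro!: continuous_on_compose2[OF continuous_on_matrix_inv])
next
  case (Suc n)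
  then obtain M' where M': "\<forall>x\<in>S. (M has_derivative M' x) (at x within S)"
      "\<forall>v. smooth_on n (\<lambda>x. M' x v) S"
    by auto
  have inv: "smooth_on n (\<lambda>x. matrix_inv (M x)) S"
    using Suc smooth_on_SucD by blast
  have "((\<lambda>x. matrix_inv (M x)) has_derivative
      (\<lambda>h. - (matrix_inv (M x) ** M' x h ** matrix_inv (M x)))) (at x within S)" if "x \<in> S" for x
    using has_derivative_compose[OF M'(1)[rule_format, OF that] has_derivative_matrix_inv[OF nz[OF that]]] .
  then show ?case
    using M'(2) inv
    by (auto intro!: exI[of _ "\<lambda>x h. - (matrix_inv (M x) ** M' x h ** matrix_inv (M x))"]
        smooth_on_minus smooth_on_matrix_mult)
qed

text \<open>No induction is involved: the first derivative is a trace of the inverse times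
  \<open>M'\<close>, which is smooth by the preceding lemmas.\<close>

lemma smooth_on_ln_det:
  fixes M :: "'a::real_normed_vector \<Rightarrow> real^'n^'n"
  assumes "smooth_on n M S" and pos: "\<And>x. x \<in> S \<Longrightarrow> det (M x) > 0"
  shows "smooth_on n (\<lambda>x. ln (det (M x))) S"
proof (cases n)
  case 0
  then have "continuous_on S (\<lambda>x. det (M x))"
    using assms(1) by (auto intro: continuous_on_compose2[OF continuous_on_det[of UNIV]])
  then show ?thesis
    using pos 0 by (auto intro!: continuous_on_ln simp: less_imp_neq[symmetric])
next
  case (Suc m)
  then obtain M' where M': "\<forall>x\<in>S. (M has_derivative M' x) (at x within S)"
      "\<forall>v. smooth_on m (\<lambda>x. M' x v) S"
    using assms(1) by auto
  have inv: "smooth_on m (\<lambda>x. matrix_inv (M x)) S"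
    using assms(1) Suc by (intro smooth_on_matrix_inv) (auto intro: smooth_on_SucD simp del: smooth_on.simps dest: pos)
  have "((\<lambda>x. ln (det (M x))) has_derivative
      (\<lambda>h. trace (matrix_inv (M x) ** M' x h))) (at x within S)" if "x \<in> S" for x
    using has_derivative_compose[OF M'(1)[rule_format, OF that] has_derivative_ln_det[OF pos[OF that]]] .
  then show ?thesis
    using M'(2) inv Suc
    by (auto intro!: exI[of _ "\<lambda>x h. trace (matrix_inv (M x) ** M' x h)"]
        smooth_on_bounded_linear[OF bounded_linear_trace] smooth_on_matrix_mult)
qed

text \<open>In finite dimension the directional derivatives assemble to a smooth operator-valued
  derivative, \<open>D x = \<Sum>b. \<langle>\<cdot>, b\<rangle> f'(x) b\<close>.\<close>

lemma smooth_on_Suc_blinfun: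
  fixes f :: "'a::euclidean_space \<Rightarrow> 'b::real_normed_vector"
  assumes "smooth_on (Suc n) f S"
  obtains D :: "'a \<Rightarrow> ('a \<Rightarrow>\<^sub>L 'b)" where
    "\<And>x. x \<in> S \<Longrightarrow> (f has_derivative blinfun_apply (D x)) (at x within S)" "smooth_on n D S"
proof -
  obtain f' where f': "\<forall>x\<in>S. (f has_derivative f' x) (at x within S)"
      "\<forall>v. smooth_on n (\<lambda>x. f' x v) S"
    using assms by auto
  define D where "D x = (\<Sum>b\<in>Basis. blinfun_scaleR_left (f' x b) o\<^sub>L blinfun_inner_left b)" for x
  have "blinfun_apply (D x) = f' x" if "x \<in> S" for x
  proof
    fix h
    have lin: "linear (f' x)"
      using f'(1) that has_derivative_linear by blast
    have "blinfun_apply (D x) h = (\<Sum>b\<in>Basis. (h \<bullet> b) *\<^sub>R f' x b)"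
      by (simp add: D_def blinfun.sum_left inner_commute)
    also have "\<dots> = f' x (\<Sum>b\<in>Basis. (h \<bullet> b) *\<^sub>R b)"
      by (simp add: linear_sum[OF lin] linear_scale[OF lin])
    finally show "blinfun_apply (D x) h = f' x h" by (simp add: euclidean_representation)
  qed
  moreover have "smooth_on n D S"
    unfolding D_def
    using f'(2)
    by (intro smooth_on_sum smooth_on_bounded_linear[OF bounded_linear_blinfun_scaleR_left]
        smooth_on_bounded_linear[OF bounded_bilinear.bounded_linear_left[OF bounded_bilinear_blinfun_compose]]) auto
  ultimately show thesis using f'(1) that[of D] by simp
qed

subsection \<open>Positive definite matrices and Schur complements\<close>

lemma inner_transpose: "x \<bullet> (transpose A *v y) = y \<bullet> ((A :: real^'n^'m) *v x)"
  by (metis dot_lmul_matrix inner_commute transpose_matrix_vector)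

lemma sym_mat_inner: "sym_mat A \<Longrightarrow> x \<bullet> (A *v y) = y \<bullet> (A *v x)"
  by (metis inner_transpose sym_mat_def)

lemma pd_mat_sym: "pd_mat A \<Longrightarrow> transpose A = A"
  by (simp add: pd_mat_def sym_mat_def)

lemma pd_mat_imp_psd: "pd_mat A \<Longrightarrow> psd_mat A"
  unfolding pd_mat_def psd_mat_def by (metis inner_zero_left less_eq_real_def)

text \<open>Gram-Schmidt: a maximal \<open>A\<close>-orthonormal set is a basis, and its elements are the rows
  of \<open>Q\<close>.\<close>

lemma pd_mat_congruent_one:
  fixes A :: "real^'n^'n"
  assumes A: "pd_mat A"
  obtains Q :: "real^'n^'n" where "Q ** A ** transpose Q = mat 1"
proof -
  have sym: "sym_mat A" and pos: "\<And>x. x \<noteq> 0 \<Longrightarrow> 0 < x \<bullet> (A *v x)"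
    using A by (auto simp: pd_mat_def)
  define orth where "orth B \<longleftrightarrow> finite B \<and> (\<forall>u\<in>B. \<forall>v\<in>B. u \<bullet> (A *v v) = (if u = v then 1 else 0))"
    for B :: "(real^'n) set"
  have coeff: "v \<bullet> (A *v (\<Sum>u\<in>B. c u *\<^sub>R u)) = c v" if "orth B" "v \<in> B" for B c v
  proof -
    have "v \<bullet> (A *v (\<Sum>u\<in>B. c u *\<^sub>R u)) = (\<Sum>u\<in>B. c u * (v \<bullet> (A *v u)))"
      by (simp add: linear_sum[OF matrix_vector_mul_linear] matrix_vector_mult_scaleR inner_sum_right)
    also have "\<dots> = (\<Sum>u\<in>B. if v = u then c u else 0)"
      using that by (intro sum.cong) (auto simp: orth_def)
    also have "\<dots> = c v" using that by (simp add: orth_def)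
    finally show ?thesis .
  qed
  have indep: "independent B" if "orth B" for B
  proof (rule independent_if_scalars_zero)
    show "finite B" using that by (simp add: orth_def)
    show "c v = 0" if "(\<Sum>u\<in>B. c u *\<^sub>R u) = 0" "v \<in> B" for c v
      using coeff[OF \<open>orth B\<close> that(2), of c] that(1) by simp
  qed
  have card_le: "card B \<le> CARD('n)" if "orth B" for B
    using independent_bound[OF indep[OF that]] by simp
  have "orth {}" by (simp add: orth_def)
  \<comment> \<open>A largest orthonormal set exists because such sets are independent and so have
    at most \<open>CARD('n)\<close> elements.\<close>
  then obtain B where B: "orth B" and max: "\<And>C. orth C \<Longrightarrow> card C \<le> card B"
    using card_le ex_has_greatest_nat[of orth "{}" card "Suc CARD('n)"] by (auto simp: less_Suc_eq_le)
  have finB: "finite B" using B by (simp add: orth_def)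
  have "card B = CARD('n)"
  proof (rule ccontr)
    assume "card B \<noteq> CARD('n)"
    then have "card B < CARD('n)" using card_le[OF B] by simp
    have "span B \<noteq> UNIV"
    proof
      assume "span B = UNIV"
      then have "dim (UNIV :: (real^'n) set) \<le> card B"
        by (intro dim_le_card[OF _ finB]) auto
      then show False using \<open>card B < CARD('n)\<close> by simp
    qed
    then obtain v where v: "v \<notin> span B" by blast
    \<comment> \<open>Subtracting the \<open>A\<close>-orthogonal projection onto the span of
      \<open>B\<close> leaves a nonzero vector. Its normalisation \<open>z\<close> would enlarge
      \<open>B\<close>, against maximality.\<close>
    define w where "w = v - (\<Sum>u\<in>B. (u \<bullet> (A *v v)) *\<^sub>R u)"
    have "w \<noteq> 0"
    proof
      assume "w = 0"
      then have "v = (\<Sum>u\<in>B. (u \<bullet> (A *v v)) *\<^sub>R u)" by (simp add: w_def)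
      also have "\<dots> \<in> span B" by (intro span_sum span_scale span_base)
      finally show False using v by simp
    qed
    have Bw: "u \<bullet> (A *v w) = 0" if "u \<in> B" for u
      using coeff[OF B that, of "\<lambda>u. u \<bullet> (A *v v)"]
      by (simp add: w_def matrix_vector_mult_diff_distrib inner_diff_right)
    define z where "z = (1 / sqrt (w \<bullet> (A *v w))) *\<^sub>R w"
    have zz: "z \<bullet> (A *v z) = 1"
      using pos[OF \<open>w \<noteq> 0\<close>] by (simp add: z_def matrix_vector_mult_scaleR field_simps)
    have Bz: "u \<bullet> (A *v z) = 0" if "u \<in> B" for u
      using Bw[OF that] by (simp add: z_def matrix_vector_mult_scaleR)
    have zB: "z \<bullet> (A *v u) = 0" if "u \<in> B" for u
      using Bz[OF that] sym_mat_inner[OF sym, of z u] by simp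
    have "z \<notin> B" using zz Bz by fastforce
    then have "orth (insert z B)"
      using B zz Bz zB by (auto simp: orth_def)
    from max[OF this] show False using \<open>z \<notin> B\<close> finB by simp
  qed
  then obtain f where f: "bij_betw f (UNIV :: 'n set) B"
    using finB by (metis finite_same_card_bij finite_class.finite_UNIV)
  define Q :: "real^'n^'n" where "Q = (\<chi> i. f i)"
  have "(Q ** A ** transpose Q) $ i $ j = mat 1 $ i $ j" for i j
  proof -
    have "(Q ** A ** transpose Q) $ i $ j = f i \<bullet> (A *v f j)"
    proof -
      have "(Q ** A ** transpose Q) $ i $ j = (Q ** (A ** transpose Q)) $ i $ j"
        by (simp add: matrix_mul_assoc)
      also have "\<dots> = f i \<bullet> (A *v f j)"
        by (simp add: matrix_matrix_mult_def matrix_vector_mult_def transpose_def Q_def inner_vec_def)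
      finally show ?thesis .
    qed
    also have "\<dots> = mat 1 $ i $ j"
    proof -
      have "f i \<in> B" "f j \<in> B" "f i = f j \<longleftrightarrow> i = j"
        using f by (auto simp: bij_betw_def inj_on_def)
      then show ?thesis using B by (auto simp: orth_def mat_def)
    qed
    finally show ?thesis .
  qed
  then have "Q ** A ** transpose Q = mat 1" by (simp add: vec_eq_iff)
  then show thesis by (rule that)
qed

text \<open>Replaces the inverse by a product of \<open>Q\<close> with its transpose, so that traces
  containing inverses become traces of matrices conjugated by \<open>Q\<close>.\<close>

lemma congruent_one_inv:
  fixes A Q :: "real^'n^'n"
  assumes "Q ** A ** transpose Q = mat 1"
  shows "matrix_inv A = transpose Q ** Q"
proof (rule matrix_inv_eqI)
  have "A ** transpose Q ** Q = mat 1"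
    using assms by (metis matrix_left_right_inverse matrix_mul_assoc)
  then show "A ** (transpose Q ** Q) = mat 1" by (simp add: matrix_mul_assoc)
qed

lemma pd_mat_det_pos:
  fixes A :: "real^'n^'n"
  assumes "pd_mat A"
  shows "det A > 0"
proof -
  obtain Q :: "real^'n^'n" where "Q ** A ** transpose Q = mat 1"
    using pd_mat_congruent_one[OF assms] .
  then have "det (Q ** A ** transpose Q) = 1" by simp
  then have "det Q * det A * det Q = 1" by (simp add: det_mul)
  then have "(det Q)\<^sup>2 * det A = 1" by (simp add: power2_eq_square mult.commute mult.left_commute)
  then show "det A > 0"
    by (metis zero_le_power2 zero_less_mult_iff zero_less_one not_less)
qed

lemma transpose_matrix_inv:
  fixes A :: "real^'n^'n"
  assumes "det A \<noteq> 0" "transpose A = A"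
  shows "transpose (matrix_inv A) = matrix_inv A"
proof -
  have "transpose (matrix_inv A ** A) = mat 1"
    by (simp add: matrix_inv_works assms(1))
  then have "A ** transpose (matrix_inv A) = mat 1"
    by (simp add: matrix_transpose_mul assms(2))
  then show ?thesis by (rule matrix_inv_eqI[symmetric])
qed

text \<open>A nonzero vector on which a semidefinite form vanishes lies in the kernel. Otherwise
  moving \<open>x\<close> a little in the direction of \<open>- (A *v x)\<close> would make the form
  negative.\<close>

lemma psd_mat_det_zero:
  fixes A :: "real^'n^'n"
  assumes A: "psd_mat A" "\<not> pd_mat A"
  shows "det A = 0"
proof -
  have sym: "sym_mat A" and nonneg: "\<And>x. 0 \<le> x \<bullet> (A *v x)"
    using A by (auto simp: psd_mat_def)
  obtain x where x: "x \<noteq> 0" "x \<bullet> (A *v x) = 0"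
    using A nonneg unfolding psd_mat_def pd_mat_def by (metis less_eq_real_def)
  have "A *v x = 0"
  proof (rule ccontr)
    assume "A *v x \<noteq> 0"
    define y where "y = A *v x"
    have yy: "y \<bullet> y > 0" using \<open>A *v x \<noteq> 0\<close> by (simp add: y_def)
    define c where "c = y \<bullet> (A *v y)"
    have c: "c \<ge> 0" using nonneg by (simp add: c_def)
    have quad: "t * (2 * (y \<bullet> y)) \<le> t\<^sup>2 * c" for t
    proof -
      have "0 \<le> (x - t *\<^sub>R y) \<bullet> (A *v (x - t *\<^sub>R y))" by (rule nonneg)
      also have "\<dots> = t\<^sup>2 * c - t * (2 * (y \<bullet> y))"
        using x(2) sym_mat_inner[OF sym, of x y]
        by (simp add: matrix_vector_mult_diff_distrib matrix_vector_mult_scaleR inner_diff_left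
            inner_diff_right c_def y_def[symmetric] power2_eq_square algebra_simps)
      finally show ?thesis by simp
    qed
    \<comment> \<open>Any small positive \<open>t\<close> contradicts \<open>quad\<close>; the
      summand 1 in the denominator covers the case \<open>c = 0\<close>.\<close>
    define t where "t = (y \<bullet> y) / (c + 1)"
    have t: "t > 0" using yy c by (simp add: t_def)
    have "2 * (y \<bullet> y) \<le> t * c"
      using quad[of t] t by (simp add: power2_eq_square)
    also have "\<dots> \<le> y \<bullet> y"
      using yy c by (simp add: t_def field_simps)
    finally show False using yy by simp
  qed
  then show ?thesis
    using x(1) by (metis invertible_det_nz matrix_inv_works(2) matrix_vector_mul_assoc matrix_vector_mul_lid matrix_vector_mult_0_right)
qed

text \<open>Writing \<open>A\<close> as \<open>R ** transpose R\<close> with \<open>R\<close> the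
  inverse of \<open>Q\<close>, submultiplicativity bounds the norm of \<open>A\<close> by the
  squared norm of \<open>R\<close>, which is the trace.\<close>

lemma pd_mat_norm_le_trace:
  fixes A :: "real^'n^'n"
  assumes A: "pd_mat A"
  shows "norm A \<le> trace A"
proof -
  obtain Q :: "real^'n^'n" where Q: "Q ** A ** transpose Q = mat 1"
    using pd_mat_congruent_one[OF A] .
  define R where "R = matrix_inv Q"
  have "det (Q ** A ** transpose Q) = 1" by (simp add: Q)
  then have detQ: "det Q \<noteq> 0" by (auto simp: det_mul)
  have RQ: "R ** Q = mat 1" unfolding R_def by (rule matrix_inv_works(2)[OF detQ])
  then have QR: "transpose Q ** transpose R = mat 1"
    by (metis matrix_transpose_mul transpose_mat)
  have "R ** transpose R = R ** (Q ** A ** transpose Q) ** transpose R"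
    by (simp add: Q)
  also have "\<dots> = (R ** Q) ** A ** (transpose Q ** transpose R)"
    by (simp add: matrix_mul_assoc)
  finally have eq: "A = R ** transpose R" by (simp add: RQ QR)
  then have "norm A \<le> norm R * norm R"
    using norm_matrix_mult_le[of R "transpose R"] by (simp add: norm_transpose)
  also have "\<dots> = R \<bullet> R" by (metis power2_norm_eq_inner power2_eq_square)
  also have "\<dots> = trace A" unfolding inner_matrix_eq_trace eq by (rule trace_mul_sym)
  finally show ?thesis .
qed

lemma trace_eq_sum_quadratic: "trace (A :: real^'n^'n) = (\<Sum>i\<in>UNIV. axis i 1 \<bullet> (A *v axis i 1))"
  by (simp add: trace_def inner_axis matrix_vector_mult_basis inner_axis' column_def)

text \<open>The quadratic form, at the stacked vector \<open>(u, v)\<close>, of the symmetric block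
  matrix with rows \<open>(X, Y)\<close> and \<open>(transpose Y, X)\<close>. Unlike the Schur
  complement it is linear in \<open>(X, Y)\<close>, which gives direct access to convexity,
  closedness and perturbation bounds.\<close>

definition block_form :: "real^'n^'n \<Rightarrow> real^'n^'n \<Rightarrow> real^'n \<Rightarrow> real^'n \<Rightarrow> real" where
  "block_form X Y u v = u \<bullet> (X *v u) + 2 * (u \<bullet> (Y *v v)) + v \<bullet> (X *v v)"

definition schur :: "real^'n^'n \<Rightarrow> real^'n^'n \<Rightarrow> real^'n^'n" where
  "schur X Y = X - Y ** matrix_inv X ** transpose Y"

lemma schur_sym:
  assumes "pd_mat X"
  shows "transpose (schur X Y) = schur X Y"
  using transpose_matrix_inv[of X] pd_mat_det_pos[OF assms] pd_mat_sym[OF assms]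
  by (simp add: schur_def transpose_diff matrix_transpose_mul matrix_mul_assoc)

text \<open>Completing the square.\<close>

lemma block_form_schur:
  fixes X Y :: "real^'n^'n"
  assumes X: "pd_mat X"
  defines "w u v \<equiv> v + matrix_inv X *v (transpose Y *v u)"
  shows "block_form X Y u v = u \<bullet> (schur X Y *v u) + w u v \<bullet> (X *v w u v)"
proof -
  have d: "det X \<noteq> 0" using pd_mat_det_pos[OF X] by simp
  define s where "s = transpose Y *v u"
  define p where "p = matrix_inv X *v s"
  have Xp: "X *v p = s"
    by (simp add: p_def matrix_vector_mul_assoc matrix_inv_works(1)[OF d])
  have sX: "sym_mat X" using X by (simp add: pd_mat_def)
  have uY: "u \<bullet> (Y *v z) = z \<bullet> s" for z
    unfolding s_def by (metis inner_transpose)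
  have "u \<bullet> (schur X Y *v u) = u \<bullet> (X *v u) - u \<bullet> (Y *v p)"
    by (simp add: schur_def matrix_vector_mult_diff_rdistrib inner_diff_right p_def s_def
        matrix_vector_mul_assoc[symmetric] del: transpose_matrix_vector)
  moreover have "(v + p) \<bullet> (X *v (v + p)) = v \<bullet> (X *v v) + 2 * (v \<bullet> s) + p \<bullet> s"
    using sym_mat_inner[OF sX, of p v]
    by (simp add: matrix_vector_right_distrib inner_add_left inner_add_right Xp)
  ultimately show ?thesis
    unfolding w_def block_form_def s_def[symmetric] p_def[symmetric] by (simp add: uY)
qed

lemma block_form_pos_iff:
  fixes X Y :: "real^'n^'n"
  assumes sX: "sym_mat X"
  shows "pd_mat X \<and> pd_mat (schur X Y) \<longleftrightarrow> (\<forall>u v. (u, v) \<noteq> (0, 0) \<longrightarrow> block_form X Y u v > 0)"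
proof (intro iffI conjI allI impI)
  fix u v :: "real^'n"
  assume XS: "pd_mat X \<and> pd_mat (schur X Y)" and nz: "(u, v) \<noteq> (0, 0)"
  then have X: "pd_mat X" and S: "pd_mat (schur X Y)" by auto
  have nonneg: "0 \<le> z \<bullet> (X *v z)" for z
    using pd_mat_imp_psd[OF X] by (simp add: psd_mat_def)
  show "block_form X Y u v > 0"
  proof (cases "u = 0")
    case True
    then show ?thesis using X nz by (simp add: block_form_def pd_mat_def)
  next
    case False
    then show ?thesis
      using S nonneg unfolding block_form_schur[OF X] pd_mat_def by (simp add: add_pos_nonneg)
  qed
next
  assume pos: "\<forall>u v. (u, v) \<noteq> (0, 0) \<longrightarrow> block_form X Y u v > 0"
  have X: "pd_mat X"
    unfolding pd_mat_def
  proof (intro conjI allI impI sX)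
    fix x :: "real^'n" assume "x \<noteq> 0"
    then show "0 < x \<bullet> (X *v x)"
      using pos[rule_format, of x 0] by (simp add: block_form_def)
  qed
  from X show "pd_mat X" .
  show "pd_mat (schur X Y)"
    unfolding pd_mat_def
  proof (intro conjI allI impI)
    show "sym_mat (schur X Y)" by (simp add: sym_mat_def schur_sym[OF X])
    fix u :: "real^'n" assume "u \<noteq> 0"
    \<comment> \<open>This choice of \<open>v\<close> makes the completed square vanish, so that
      only the Schur complement remains.\<close>
    then show "0 < u \<bullet> (schur X Y *v u)"
      using pos[rule_format, of u "- (matrix_inv X *v (transpose Y *v u))"]
      by (simp add: block_form_schur[OF X])
  qed
qed

lemma block_form_diff:
  "block_form X Y u v - block_form X' Y' u v = block_form (X - X') (Y - Y') u v"
  by (simp add: block_form_def matrix_vector_mult_diff_rdistrib inner_diff_right algebra_simps)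

lemma block_form_mat_add:
  "block_form (X + e *\<^sub>R mat 1) Y u v = block_form X Y u v + e * (u \<bullet> u + v \<bullet> v)"
  by (simp add: block_form_def matrix_vector_mult_add_rdistrib scaleR_matrix_vector_assoc[symmetric]
      inner_add_right algebra_simps)

lemma block_form_abs_le:
  "\<bar>block_form X Y u v\<bar> \<le> (norm X + norm Y) * (u \<bullet> u + v \<bullet> v)"
proof -
  have q: "\<bar>x \<bullet> (A *v y)\<bar> \<le> norm A * (norm x * norm y)" for A :: "real^'n^'n" and x y
  proof -
    have "\<bar>x \<bullet> (A *v y)\<bar> \<le> norm x * norm (A *v y)" by (rule Cauchy_Schwarz_ineq2)
    also have "\<dots> \<le> norm x * (norm A * norm y)"
      by (intro mult_left_mono norm_matrix_vector_le) auto
    finally show ?thesis by (simp add: algebra_simps)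
  qed
  have sq: "z \<bullet> z = norm z * norm z" for z :: "real^'n"
    by (metis power2_norm_eq_inner power2_eq_square)
  have "2 * \<bar>u \<bullet> (Y *v v)\<bar> \<le> norm Y * (2 * (norm u * norm v))"
    using q[of u Y v] by simp
  also have "\<dots> \<le> norm Y * (u \<bullet> u + v \<bullet> v)"
    using sum_squares_bound[of "norm u" "norm v"]
    by (intro mult_left_mono) (auto simp: sq power2_eq_square)
  finally have "2 * \<bar>u \<bullet> (Y *v v)\<bar> \<le> norm Y * (u \<bullet> u + v \<bullet> v)" .
  moreover have "\<bar>u \<bullet> (X *v u)\<bar> \<le> norm X * (u \<bullet> u)" "\<bar>v \<bullet> (X *v v)\<bar> \<le> norm X * (v \<bullet> v)"
    using q[of u X u] q[of v X v] by (auto simp: sq)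
  ultimately show ?thesis
    unfolding block_form_def by (simp add: algebra_simps)
qed

lemma block_form_scale: "block_form X Y (c *\<^sub>R u) (c *\<^sub>R v) = c\<^sup>2 * block_form X Y u v"
  by (simp add: block_form_def matrix_vector_mult_scaleR power2_eq_square algebra_simps)

text \<open>The constant is the minimum of the form over the compact unit sphere; homogeneity of
  degree 2 extends the bound to all vectors.\<close>

lemma block_form_coercive:
  fixes X Y :: "real^'n^'n"
  assumes pos: "\<And>u v. (u, v) \<noteq> (0, 0) \<Longrightarrow> block_form X Y u v > 0"
  obtains c where "c > 0" "\<And>u v. block_form X Y u v \<ge> c * (u \<bullet> u + v \<bullet> v)"
proof -
  let ?S = "sphere (0 :: (real^'n) \<times> (real^'n)) 1"
  have lin: "continuous_on UNIV (\<lambda>x. (A :: real^'n^'n) *v x)" for A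
    by (simp add: linear_continuous_on matrix_vector_mul_bounded_linear)
  have "continuous_on ?S (\<lambda>p. block_form X Y (fst p) (snd p))"
    unfolding block_form_def
    by (intro continuous_intros continuous_on_compose2[OF lin]) auto
  moreover have "compact ?S" by simp
  moreover have "?S \<noteq> {}" by simp
  ultimately obtain p where p: "p \<in> ?S"
      "\<And>q. q \<in> ?S \<Longrightarrow> block_form X Y (fst p) (snd p) \<le> block_form X Y (fst q) (snd q)"
    using continuous_attains_inf[of ?S "\<lambda>p. block_form X Y (fst p) (snd p)"] by blast
  define c where "c = block_form X Y (fst p) (snd p)"
  have "p \<noteq> 0" using p(1) by auto
  then have c: "c > 0" unfolding c_def by (intro pos) (auto simp: prod_eq_iff)
  have "block_form X Y u v \<ge> c * (u \<bullet> u + v \<bullet> v)" for u v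
  proof (cases "(u, v) = (0, 0)")
    case True
    then show ?thesis by (simp add: block_form_def)
  next
    case False
    define r where "r = norm (u, v)"
    have r: "r > 0" "r\<^sup>2 = u \<bullet> u + v \<bullet> v"
      using False by (auto simp: r_def power2_norm_eq_inner zero_prod_def)
    have "(1 / r) *\<^sub>R (u, v) \<in> ?S" using r(1) by (simp add: r_def[symmetric] del: scaleR_Pair)
    from p(2)[OF this] have "c \<le> (1 / r)\<^sup>2 * block_form X Y u v"
      using block_form_scale[of X Y "1 / r" u v] by (simp add: c_def)
    then have "c \<le> block_form X Y u v / r\<^sup>2" by (simp add: power_divide)
    then have "c * r\<^sup>2 \<le> block_form X Y u v" using r(1) by (simp add: pos_le_divide_eq)
    then show ?thesis by (simp add: r(2))
  qed
  then show thesis using c that by blast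
qed

subsection \<open>The cone and its interior\<close>

lemma Fhat_dom_iff_schur:
  "(X, Y) \<in> Fhat_dom \<longleftrightarrow> pd_mat X \<and> (\<forall>i. pd_mat (schur X (Y $ i)))"
  by (simp add: Fhat_dom_def schur_def)

lemma Fhat_dom_iff:
  fixes X :: "real^'n^'n" and Y :: "real^'n^'n^'k"
  shows "(X, Y) \<in> Fhat_dom \<longleftrightarrow>
    sym_mat X \<and> (\<forall>i u v. (u, v) \<noteq> (0, 0) \<longrightarrow> block_form X (Y $ i) u v > 0)"
proof (cases "sym_mat X")
  case True
  then show ?thesis
    unfolding Fhat_dom_iff_schur using block_form_pos_iff[OF True] by metis
next
  case False
  then show ?thesis by (auto simp: Fhat_dom_iff_schur pd_mat_def)
qed

lemma closed_block_psd: "closed {(X :: real^'n^'n, Y). sym_mat X \<and> (\<forall>u v. block_form X Y u v \<ge> 0)}"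
proof -
  have eq: "{(X :: real^'n^'n, Y). sym_mat X \<and> (\<forall>u v. block_form X Y u v \<ge> 0)}
    = {p. transpose (fst p) = fst p} \<inter> (\<Inter>u. \<Inter>v. {p. 0 \<le> block_form (fst p) (snd p) u v})"
    by (auto simp: sym_mat_def)
  have mv: "bounded_linear (\<lambda>A :: real^'n^'n. A *v x)" for x
    by (rule bounded_linearI'[where 'a="real^'n^'n"])
      (auto simp: matrix_vector_mult_add_rdistrib scaleR_matrix_vector_assoc)
  show ?thesis
    unfolding eq unfolding block_form_def
    by (intro closed_Int closed_INT ballI closed_Collect_eq closed_Collect_le continuous_intros
        bounded_linear.continuous_on[OF bounded_linear_transpose] bounded_linear.continuous_on[OF mv])
qed

text \<open>One inclusion holds because the right-hand side is closed and contains the set whose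
  closure is taken. For the other, adding small multiples of the identity to \<open>X\<close> makes
  the form strictly positive.\<close>

lemma K2_l2_eq: "K2_l2 = {(X :: real^'n^'n, Y). sym_mat X \<and> (\<forall>u v. block_form X Y u v \<ge> 0)}"
proof
  let ?S = "{(X :: real^'n^'n, Y). pd_mat X \<and> pd_mat (X - Y ** matrix_inv X ** transpose Y)}"
  have S: "(X, Y) \<in> ?S \<longleftrightarrow> sym_mat X \<and> (\<forall>u v. (u, v) \<noteq> (0, 0) \<longrightarrow> block_form X Y u v > 0)" for X Y
    using block_form_pos_iff[of X Y] by (auto simp: schur_def pd_mat_def)
  show "K2_l2 \<subseteq> {(X :: real^'n^'n, Y). sym_mat X \<and> (\<forall>u v. block_form X Y u v \<ge> 0)}"
    unfolding K2_l2_def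
  proof (rule closure_minimal[OF _ closed_block_psd], safe)
    fix X Y :: "real^'n^'n" and u v
    assume "pd_mat X" "pd_mat (X - Y ** matrix_inv X ** transpose Y)"
    then have XY: "(X, Y) \<in> ?S" by simp
    then show "sym_mat X" using S by blast
    show "block_form X Y u v \<ge> 0"
      using XY[unfolded S] by (cases "(u, v) = (0, 0)") (auto simp: block_form_def less_imp_le)
  qed
  show "{(X :: real^'n^'n, Y). sym_mat X \<and> (\<forall>u v. block_form X Y u v \<ge> 0)} \<subseteq> K2_l2"
  proof clarify
    fix X Y :: "real^'n^'n"
    assume X: "sym_mat X" and nn: "\<forall>u v. block_form X Y u v \<ge> 0"
    define f where "f k = (X + inverse (real (Suc k)) *\<^sub>R mat 1, Y)" for k
    have "f k \<in> ?S" for k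
      unfolding f_def S
    proof (intro conjI allI impI)
      show "sym_mat (X + inverse (real (Suc k)) *\<^sub>R mat 1)"
        using X by (simp add: sym_mat_def transpose_add transpose_scalar)
      fix u v :: "real^'n" assume "(u, v) \<noteq> (0, 0)"
      then have "u \<bullet> u + v \<bullet> v > 0"
        by (metis add_nonneg_pos add_pos_nonneg inner_ge_zero inner_gt_zero_iff prod.inject)
      then show "0 < block_form (X + inverse (real (Suc k)) *\<^sub>R mat 1) Y u v"
        unfolding block_form_mat_add using nn by (simp add: add_nonneg_pos)
    qed
    moreover have "f \<longlonglongrightarrow> (X + 0 *\<^sub>R mat 1, Y)"
      unfolding f_def by (intro tendsto_intros LIMSEQ_inverse_real_of_nat)
    ultimately show "(X, Y) \<in> K2_l2"
      unfolding K2_l2_def closure_sequential by (intro exI[of _ f]) auto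
  qed
qed

lemma Km_linf_iff:
  fixes X :: "real^'n^'n" and Y :: "real^'n^'n^'k"
  shows "(X, Y) \<in> Km_linf \<longleftrightarrow> sym_mat X \<and> (\<forall>i u v. block_form X (Y $ i) u v \<ge> 0)"
proof -
  have "psd_mat X" if "sym_mat X" "\<forall>i u v. block_form X (Y $ i) u v \<ge> 0"
    unfolding psd_mat_def
  proof (intro conjI allI that(1))
    \<comment> \<open>At \<open>(x, 0)\<close> the block form is the quadratic form of
      \<open>X\<close>. The term \<open>undefined\<close> merely names some index of the nonempty
      type \<open>'k\<close>.\<close>
    show "0 \<le> x \<bullet> (X *v x)" for x
      using that(2)[rule_format, of undefined x 0] by (simp add: block_form_def)
  qed
  then show ?thesis by (auto simp: Km_linf_def K2_l2_eq)
qed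

lemma subspace_amb_space: "subspace amb_space"
  by (auto simp: subspace_def amb_space_def sym_mat_def transpose_add transpose_scalar zero_prod_def
      transpose_def vec_eq_iff)

lemma closed_Km_linf: "closed (Km_linf :: ((real^'n^'n) \<times> (real^'n^'n^'k)) set)"
proof -
  have eq: "(Km_linf :: ((real^'n^'n) \<times> (real^'n^'n^'k)) set) = (\<Inter>i. (\<lambda>p. (fst p, snd p $ i)) -` K2_l2)"
    by (auto simp: Km_linf_iff K2_l2_eq)
  have "closed (K2_l2 :: ((real^'n^'n) \<times> (real^'n^'n)) set)"
    by (simp add: K2_l2_def)
  then show ?thesis
    unfolding eq by (intro closed_INT ballI closed_vimage continuous_intros)
qed

lemma block_form_combination:
  "block_form (a *\<^sub>R X + b *\<^sub>R X') (a *\<^sub>R Y + b *\<^sub>R Y') u v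
    = a * block_form X Y u v + b * block_form X' Y' u v"
  by (simp add: block_form_def matrix_vector_mult_add_rdistrib scaleR_matrix_vector_assoc[symmetric]
      inner_add_right algebra_simps)

lemma sym_mat_combination: "sym_mat X \<Longrightarrow> sym_mat X' \<Longrightarrow> sym_mat (a *\<^sub>R X + b *\<^sub>R X')"
  by (simp add: sym_mat_def transpose_add transpose_scalar)

lemma convex_Km_linf: "convex (Km_linf :: ((real^'n^'n) \<times> (real^'n^'n^'k)) set)"
  by (rule convexI) (auto simp: Km_linf_iff sym_mat_combination block_form_combination)

lemma convex_Fhat_dom: "convex (Fhat_dom :: ((real^'n^'n) \<times> (real^'n^'n^'k)) set)"
proof (rule convexI, clarify)
  fix X X' :: "real^'n^'n" and Y Y' :: "real^'n^'n^'k" and a b :: real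
  assume p: "(X, Y) \<in> Fhat_dom" "(X', Y') \<in> Fhat_dom" and ab: "0 \<le> a" "0 \<le> b" "a + b = 1"
  have "block_form (a *\<^sub>R X + b *\<^sub>R X') ((a *\<^sub>R Y + b *\<^sub>R Y') $ i) u v > 0"
    if "(u, v) \<noteq> (0, 0)" for i u v
  proof -
    have "block_form X (Y $ i) u v > 0" "block_form X' (Y' $ i) u v > 0"
      using p that by (auto simp: Fhat_dom_iff)
    \<comment> \<open>If \<open>a = 0\<close> then \<open>b = 1\<close>, and the second form alone
      supplies positivity.\<close>
    then show ?thesis
      using ab by (cases "a = 0") (auto simp: block_form_combination intro: add_pos_nonneg)
  qed
  then show "a *\<^sub>R (X, Y) + b *\<^sub>R (X', Y') \<in> Fhat_dom"
    using p by (simp add: Fhat_dom_iff sym_mat_combination)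
qed

lemma Fhat_dom_subset_amb: "Fhat_dom \<subseteq> amb_space"
  by (auto simp: Fhat_dom_def amb_space_def pd_mat_def)

lemma openin_Fhat_dom:
  "openin (top_of_set amb_space) (Fhat_dom :: ((real^'n^'n) \<times> (real^'n^'n^'k)) set)"
  unfolding openin_euclidean_subtopology_iff
proof (intro conjI ballI Fhat_dom_subset_amb)
  fix p :: "(real^'n^'n) \<times> (real^'n^'n^'k)"
  assume p: "p \<in> Fhat_dom"
  obtain X Y where XY: "p = (X, Y)" by (cases p)
  have "\<forall>i. \<exists>c. c > 0 \<and> (\<forall>u v. block_form X (Y $ i) u v \<ge> c * (u \<bullet> u + v \<bullet> v))"
  proof
    fix i
    have "block_form X (Y $ i) u v > 0" if "(u, v) \<noteq> (0, 0)" for u v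
      using p that by (auto simp: XY Fhat_dom_iff)
    from block_form_coercive[OF this]
    show "\<exists>c. c > 0 \<and> (\<forall>u v. block_form X (Y $ i) u v \<ge> c * (u \<bullet> u + v \<bullet> v))" by metis
  qed
  then obtain c where c: "\<And>i. c i > 0" "\<And>i u v. block_form X (Y $ i) u v \<ge> c i * (u \<bullet> u + v \<bullet> v)"
    by metis
  \<comment> \<open>Moving \<open>X\<close> and \<open>Y $ i\<close> by less than \<open>e\<close>
    each changes the form by less than \<open>2 * e\<close> times the squared length of
    \<open>(u, v)\<close>, which coercivity absorbs. The minimum is positive because there are
    finitely many blocks.\<close>
  define e where "e = Min (range c) / 2"
  have e: "e > 0" "\<And>i. 2 * e \<le> c i"
    using c(1) by (auto simp: e_def)
  have "q \<in> Fhat_dom" if q: "q \<in> amb_space" "dist q p < e" for q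
  proof -
    obtain X' Y' where XY': "q = (X', Y')" by (cases q)
    have d: "norm (q - p) < e" using q(2) by (simp add: dist_norm)
    have dX: "norm (X' - X) < e"
      using norm_fst_le[of "X' - X" "Y' - Y"] d by (simp add: XY XY')
    have dY: "norm (Y' $ i - Y $ i) < e" for i
      using norm_snd_le[of "Y' - Y" "X' - X"] Finite_Cartesian_Product.norm_nth_le[of "Y' - Y" i] d by (simp add: XY XY')
    have "block_form X' (Y' $ i) u v > 0" if nz: "(u, v) \<noteq> (0, 0)" for i u v
    proof -
      have uv: "u \<bullet> u + v \<bullet> v > 0" using nz
        by (metis add_nonneg_pos add_pos_nonneg inner_ge_zero inner_gt_zero_iff prod.inject)
      have "\<bar>block_form X' (Y' $ i) u v - block_form X (Y $ i) u v\<bar>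
          \<le> (norm (X' - X) + norm (Y' $ i - Y $ i)) * (u \<bullet> u + v \<bullet> v)"
        unfolding block_form_diff by (rule block_form_abs_le)
      also have "\<dots> < 2 * e * (u \<bullet> u + v \<bullet> v)"
        using dX dY[of i] uv by (intro mult_strict_right_mono) auto
      also have "\<dots> \<le> c i * (u \<bullet> u + v \<bullet> v)"
        using e(2)[of i] uv by (intro mult_right_mono) auto
      also have "\<dots> \<le> block_form X (Y $ i) u v" by (rule c(2))
      finally show ?thesis by linarith
    qed
    then show ?thesis using q(1) by (auto simp: XY' Fhat_dom_iff amb_space_def)
  qed
  then show "\<exists>e>0. \<forall>q\<in>amb_space. dist q p < e \<longrightarrow> q \<in> Fhat_dom" using e(1) by blast
qed

lemma Fhat_dom_subset_Km: "Fhat_dom \<subseteq> Km_linf"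
proof clarify
  fix X :: "real^'n^'n" and Y :: "real^'n^'n^'k"
  assume XY: "(X, Y) \<in> Fhat_dom"
  have "block_form X (Y $ i) u v \<ge> 0" for i u v
    using XY by (cases "(u, v) = (0, 0)") (auto simp: Fhat_dom_iff block_form_def less_imp_le)
  then show "(X, Y) \<in> Km_linf" using XY by (simp add: Km_linf_iff Fhat_dom_iff)
qed

text \<open>At an interior point, subtracting a small multiple of the identity from \<open>X\<close>
  stays in the cone. This bounds every block form below by a positive multiple of the squared
  length, hence strict positivity.\<close>

lemma Fhat_dom_eq_interior:
  "(Fhat_dom :: ((real^'n^'n) \<times> (real^'n^'n^'k)) set) = interior_in amb_space Km_linf"
proof
  show "Fhat_dom \<subseteq> interior_in amb_space (Km_linf :: ((real^'n^'n) \<times> (real^'n^'n^'k)) set)"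
    unfolding interior_in_def using openin_Fhat_dom Fhat_dom_subset_Km by blast
  show "interior_in amb_space (Km_linf :: ((real^'n^'n) \<times> (real^'n^'n^'k)) set) \<subseteq> Fhat_dom"
  proof clarify
    fix X :: "real^'n^'n" and Y :: "real^'n^'n^'k"
    assume "(X, Y) \<in> interior_in amb_space Km_linf"
    then obtain T where T: "openin (top_of_set amb_space) T" "(X, Y) \<in> T" "T \<subseteq> Km_linf"
      by (auto simp: interior_in_def)
    then obtain e where e: "e > 0" "\<And>q. q \<in> amb_space \<Longrightarrow> dist q (X, Y) < e \<Longrightarrow> q \<in> T"
      unfolding openin_euclidean_subtopology_iff by metis
    have sX: "sym_mat X" using T by (auto simp: Km_linf_iff)
    let ?I = "mat 1 :: real^'n^'n"
    \<comment> \<open>The shift has norm at most \<open>e / 2\<close>; adding 1 keeps the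
      denominator visibly positive.\<close>
    define d where "d = (e / 2) / (norm ?I + 1)"
    have n1: "norm ?I + 1 > 0" by (simp add: add_nonneg_pos)
    have d: "d > 0" using e(1) n1 by (simp add: d_def)
    have "d * norm ?I \<le> d * (norm ?I + 1)" using d by simp
    also have "\<dots> = e / 2" using d_def n1 by (metis less_irrefl nonzero_eq_divide_eq)
    also have "\<dots> < e" using e(1) by simp
    finally have small: "d * norm ?I < e" .
    have "(X + (- d) *\<^sub>R ?I, Y) \<in> T"
      using sX small d by (intro e(2)) (auto simp: amb_space_def sym_mat_def transpose_diff transpose_scalar
          dist_norm norm_Pair)
    then have "(X + (- d) *\<^sub>R ?I, Y) \<in> Km_linf" using T by blast
    then have nn: "block_form X (Y $ i) u v + (- d) * (u \<bullet> u + v \<bullet> v) \<ge> 0" for i u v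
      unfolding Km_linf_iff block_form_mat_add by blast
    have "block_form X (Y $ i) u v > 0" if nz: "(u, v) \<noteq> (0, 0)" for i u v
    proof -
      have uv: "u \<bullet> u + v \<bullet> v > 0" using nz
        by (metis add_nonneg_pos add_pos_nonneg inner_ge_zero inner_gt_zero_iff prod.inject)
      then show ?thesis using nn[of i u v] mult_pos_pos[OF d uv] by simp
    qed
    then show "(X, Y) \<in> Fhat_dom" using sX by (simp add: Fhat_dom_iff)
  qed
qed

lemma Fhat_dom_nonempty: "(Fhat_dom :: ((real^'n^'n) \<times> (real^'n^'n^'k)) set) \<noteq> {}"
proof -
  have "block_form (mat 1 :: real^'n^'n) 0 u v > 0" if nz: "(u, v) \<noteq> (0, 0)" for u v
    using nz by (simp add: block_form_def)
      (metis add_nonneg_pos add_pos_nonneg inner_ge_zero inner_gt_zero_iff)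
  then have "(mat 1, 0) \<in> (Fhat_dom :: ((real^'n^'n) \<times> (real^'n^'n^'k)) set)"
    by (simp add: Fhat_dom_iff sym_mat_def)
  then show ?thesis by blast
qed

lemma Fhat_eq: "Fhat (X, Y) = - (\<Sum>i\<in>UNIV. ln (det (schur X (Y $ i)))) - ln (det X)"
  by (simp add: Fhat_def schur_def)

text \<open>Evaluate the nonnegative block form at the \<open>v\<close> for which the completed
  square vanishes.\<close>

lemma Km_schur_psd:
  fixes X :: "real^'n^'n" and Y :: "real^'n^'n^'k"
  assumes K: "(X, Y) \<in> Km_linf" and X: "pd_mat X"
  shows "psd_mat (schur X (Y $ i))"
  unfolding psd_mat_def
proof (intro conjI allI)
  show "sym_mat (schur X (Y $ i))" by (simp add: sym_mat_def schur_sym[OF X])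
  show "0 \<le> u \<bullet> (schur X (Y $ i) *v u)" for u
    using K block_form_schur[OF X, of "Y $ i" u "- (matrix_inv X *v (transpose (Y $ i) *v u))"]
    unfolding Km_linf_iff by (simp; metis)
qed

text \<open>The subtracted matrix is a congruence transform of the semidefinite inverse of
  \<open>X\<close>, so its trace is nonnegative.\<close>

lemma schur_trace_le:
  fixes X Y :: "real^'n^'n"
  assumes X: "pd_mat X"
  shows "trace (schur X Y) \<le> trace X"
proof -
  have "psd_mat (matrix_inv X)"
  proof -
    obtain Q :: "real^'n^'n" where Q: "Q ** X ** transpose Q = mat 1"
      using pd_mat_congruent_one[OF X] .
    have "0 \<le> x \<bullet> ((transpose Q ** Q) *v x)" for x
      using inner_ge_zero[of "Q *v x"]
      by (simp add: matrix_vector_mul_assoc[symmetric] inner_transpose del: transpose_matrix_vector)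
    then show ?thesis
      unfolding congruent_one_inv[OF Q] psd_mat_def sym_mat_def by (simp add: matrix_transpose_mul)
  qed
  then have "0 \<le> u \<bullet> ((Y ** matrix_inv X ** transpose Y) *v u)" for u
    using inner_transpose[of "matrix_inv X *v (transpose Y *v u)" Y u]
    unfolding psd_mat_def matrix_vector_mul_assoc[symmetric] by (metis inner_commute)
  then have "0 \<le> trace (Y ** matrix_inv X ** transpose Y)"
    unfolding trace_eq_sum_quadratic by (intro sum_nonneg) auto
  then show ?thesis by (simp add: schur_def trace_sub)
qed

text \<open>Compactness of the ball gives a bound; raising it to at least 1 makes its logarithm
  nonnegative.\<close>

lemma det_bounded_on_bounded:
  obtains C where "C \<ge> 1" "\<And>A :: real^'n^'n. norm A \<le> r \<Longrightarrow> det A \<le> C"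
proof -
  have "compact ((det :: real^'n^'n \<Rightarrow> real) ` cball 0 r)"
    by (intro compact_continuous_image continuous_on_det) auto
  then obtain B where "\<forall>x\<in>(det :: real^'n^'n \<Rightarrow> real) ` cball 0 r. norm x \<le> B"
    using compact_imp_bounded bounded_iff by metis
  then have "\<And>A :: real^'n^'n. norm A \<le> r \<Longrightarrow> det A \<le> max 1 B"
    by (force simp: le_max_iff_disj)
  then show thesis using that[of "max 1 B"] by simp
qed

lemma filterlim_minus_ln_at_top:
  assumes "\<And>k. d k > 0" "d \<longlonglongrightarrow> (0::real)"
  shows "filterlim (\<lambda>k. - ln (d k)) at_top sequentially"
proof -
  have "filterlim d (at_right 0) sequentially"
    using assms by (auto simp: filterlim_at less_imp_neq[symmetric] intro!: always_eventually)
  then have "filterlim (\<lambda>k. ln (d k)) at_bot sequentially"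
    by (rule filterlim_compose[OF ln_at_0])
  then show ?thesis by (simp add: filterlim_uminus_at_top)
qed

text \<open>Every determinant stays bounded along a convergent sequence (the Schur complements are
  dominated by \<open>X\<close>), and at a boundary point one of them vanishes.\<close>

lemma Fhat_barrier:
  fixes xs :: "nat \<Rightarrow> (real^'n^'n) \<times> (real^'n^'n^'k)"
  assumes xs: "\<And>k. xs k \<in> Fhat_dom" and lim: "xs \<longlonglongrightarrow> p" and p: "p \<in> Km_linf - Fhat_dom"
  shows "filterlim (\<lambda>k. Fhat (xs k)) at_top sequentially"
proof -
  define X where "X k = fst (xs k)" for k
  define Y where "Y k = snd (xs k)" for k
  have xs_eq: "xs k = (X k, Y k)" for k by (simp add: X_def Y_def)
  have pdX: "pd_mat (X k)" and pdS: "pd_mat (schur (X k) (Y k $ i))" for k i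
    using xs[of k] by (auto simp: xs_eq Fhat_dom_iff_schur)
  have limX: "X \<longlonglongrightarrow> fst p" unfolding X_def by (intro tendsto_intros lim)
  have limY: "(\<lambda>k. Y k $ i) \<longlonglongrightarrow> snd p $ i" for i unfolding Y_def by (intro tendsto_intros lim)
  have "(\<lambda>k. trace (X k)) \<longlonglongrightarrow> trace (fst p)"
    by (rule bounded_linear.tendsto[OF bounded_linear_trace limX])
  then have "Bseq (\<lambda>k. trace (X k))" using convergent_imp_Bseq convergentI by blast
  \<comment> \<open>One bound on the traces controls the norms of all \<open>X k\<close> and, by
    \<open>schur_trace_le\<close>, of all Schur complements.\<close>
  then obtain r where r: "\<And>k. norm (trace (X k)) \<le> r" unfolding Bseq_def by blast
  obtain C where C: "C \<ge> 1" "\<And>A :: real^'n^'n. norm A \<le> r \<Longrightarrow> det A \<le> C"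
    using det_bounded_on_bounded by blast
  have CX: "det (X k) \<le> C" for k
    using pd_mat_norm_le_trace[OF pdX[of k]] r[of k] by (intro C(2)) auto
  have CS: "det (schur (X k) (Y k $ i)) \<le> C" for k i
    using pd_mat_norm_le_trace[OF pdS[of k i]] schur_trace_le[OF pdX[of k], of "Y k $ i"] r[of k]
    by (intro C(2)) auto
  have lnC: "0 \<le> ln C" using C(1) by simp
  have lnX: "ln (det (X k)) \<le> ln C" for k
    using CX pd_mat_det_pos[OF pdX] C(1) by (simp add: ln_le_cancel_iff)
  have lnS: "ln (det (schur (X k) (Y k $ i))) \<le> ln C" for k i
    using CS pd_mat_det_pos[OF pdS] C(1) by (simp add: ln_le_cancel_iff)
  have Km: "(fst p, snd p) \<in> Km_linf" using p by simp
  show ?thesis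
  proof (cases "pd_mat (fst p)")
    \<comment> \<open>Here \<open>X\<close> becomes singular in the limit: its own logarithmic term
      blows up while every Schur term stays bounded below after the sign change.\<close>
    case False
    have "psd_mat (fst p)" using p by (auto simp: Km_linf_def)
    then have "det (fst p) = 0" using False by (rule psd_mat_det_zero)
    moreover have "(\<lambda>k. det (X k)) \<longlonglongrightarrow> det (fst p)"
      using continuous_on_det[of UNIV] limX by (rule continuous_on_tendsto_compose) auto
    ultimately have top: "filterlim (\<lambda>k. - ln (det (X k))) at_top sequentially"
      using pd_mat_det_pos[OF pdX] by (intro filterlim_minus_ln_at_top) auto
    have "- (real CARD('k) * ln C) + - ln (det (X k)) \<le> Fhat (xs k)" for k
    proof -
      have "(\<Sum>i\<in>UNIV. ln (det (schur (X k) (Y k $ i)))) \<le> of_nat CARD('k) * ln C"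
        using lnS by (intro sum_bounded_above) auto
      then show ?thesis by (simp add: xs_eq Fhat_eq)
    qed
    then show ?thesis
      by (intro filterlim_at_top_mono[OF filterlim_tendsto_add_at_top[OF tendsto_const top]]
          always_eventually) auto
  next
    \<comment> \<open>The limit of \<open>X\<close> is invertible, so inverses and Schur complements
      converge, and some limiting Schur complement is singular.\<close>
    case True
    have "(fst p, snd p) \<notin> Fhat_dom" using p by simp
    then obtain i where i: "\<not> pd_mat (schur (fst p) (snd p $ i))"
      using True unfolding Fhat_dom_iff_schur by blast
    have "det (schur (fst p) (snd p $ i)) = 0"
      by (rule psd_mat_det_zero[OF Km_schur_psd[OF Km True] i])
    moreover have "(\<lambda>k. det (schur (X k) (Y k $ i))) \<longlonglongrightarrow> det (schur (fst p) (snd p $ i))"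
    proof -
      have inv: "(\<lambda>k. matrix_inv (X k)) \<longlonglongrightarrow> matrix_inv (fst p)"
        using isCont_tendsto_compose[OF isCont_matrix_inv limX] pd_mat_det_pos[OF True] by simp
      have "(\<lambda>k. schur (X k) (Y k $ i)) \<longlonglongrightarrow> schur (fst p) (snd p $ i)"
        unfolding schur_def
        by (intro tendsto_diff limX bounded_bilinear.tendsto[OF bounded_bilinear_matrix_mult] limY inv
            bounded_linear.tendsto[OF bounded_linear_transpose])
      then show ?thesis
        using continuous_on_tendsto_compose[OF continuous_on_det[of UNIV]] by auto
    qed
    ultimately have top: "filterlim (\<lambda>k. - ln (det (schur (X k) (Y k $ i)))) at_top sequentially"
      using pd_mat_det_pos[OF pdS] by (intro filterlim_minus_ln_at_top) auto
    have "- (real CARD('k) * ln C + ln C) + - ln (det (schur (X k) (Y k $ i))) \<le> Fhat (xs k)" for k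
    proof -
      \<comment> \<open>The singular block is split off. Since \<open>ln C\<close> is nonnegative,
        the number of remaining blocks may be enlarged to \<open>CARD('k)\<close>.\<close>
      have "(\<Sum>j\<in>UNIV - {i}. ln (det (schur (X k) (Y k $ j)))) \<le> of_nat (card (UNIV - {i})) * ln C"
        using lnS by (intro sum_bounded_above) auto
      also have "\<dots> \<le> real CARD('k) * ln C"
        using lnC by (intro mult_right_mono) (auto intro!: card_mono)
      finally have "(\<Sum>j\<in>UNIV. ln (det (schur (X k) (Y k $ j))))
          \<le> ln (det (schur (X k) (Y k $ i))) + real CARD('k) * ln C"
        by (subst sum.remove[of _ i]) auto
      then show ?thesis using lnX[of k] by (simp add: xs_eq Fhat_eq)
    qed
    then show ?thesis
      by (intro filterlim_at_top_mono[OF filterlim_tendsto_add_at_top[OF tendsto_const top]]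
          always_eventually) auto
  qed
qed

subsection \<open>Derivatives along lines\<close>

lemmas has_vd_matrix_mult = bounded_bilinear.has_vector_derivative[OF bounded_bilinear_matrix_mult]
lemmas has_vd_transpose = bounded_linear.has_vector_derivative[OF bounded_linear_transpose]

lemma has_vector_derivative_matrix_inv:
  fixes M :: "real \<Rightarrow> real^'n^'n"
  assumes "(M has_vector_derivative M') (at t)" "det (M t) \<noteq> 0"
  shows "((\<lambda>t. matrix_inv (M t)) has_vector_derivative
    - (matrix_inv (M t) ** M' ** matrix_inv (M t))) (at t)"
  using has_derivative_compose[OF assms(1)[unfolded has_vector_derivative_def]
      has_derivative_matrix_inv[OF assms(2)]]
  unfolding has_vector_derivative_def by (simp add: matrix_mult_simps)

lemma trace_minus: "trace (- A :: real^'n^'n) = - trace A"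
  by (simp add: trace_def sum_negf)

lemma trace_scaleR: "trace (c *\<^sub>R A :: real^'n^'n) = c * trace A"
  by (simp add: trace_def sum_distrib_left)

lemma has_real_derivative_ln_det:
  fixes M :: "real \<Rightarrow> real^'n^'n"
  assumes "(M has_vector_derivative M') (at t)" "det (M t) > 0"
  shows "((\<lambda>t. ln (det (M t))) has_real_derivative trace (matrix_inv (M t) ** M')) (at t)"
  using has_derivative_compose[OF assms(1)[unfolded has_vector_derivative_def]
      has_derivative_ln_det[OF assms(2)]]
  unfolding has_field_derivative_def
  by (simp add: matrix_mult_simps trace_scaleR mult.commute[of _ "trace _"])

lemma has_real_derivative_trace:
  assumes "(M has_vector_derivative M') (at t)"
  shows "((\<lambda>t. trace (M t :: real^'n^'n)) has_real_derivative trace M') (at t)"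
  using bounded_linear.has_vector_derivative[OF bounded_linear_trace assms]
  by (simp add: has_real_derivative_iff_has_vector_derivative)

lemma ln_det_derivatives:
  fixes M M1 M2 :: "real \<Rightarrow> real^'n^'n"
  defines "Z \<equiv> \<lambda>t. matrix_inv (M t)"
  assumes d: "det (M t) > 0"
    and M: "(M has_vector_derivative M1 t) (at t)"
    and M1: "(M1 has_vector_derivative M2 t) (at t)"
    and M2: "(M2 has_vector_derivative M3) (at t)"
  shows "((\<lambda>t. - ln (det (M t))) has_real_derivative - trace (Z t ** M1 t)) (at t)"
    and "((\<lambda>t. - trace (Z t ** M1 t)) has_real_derivative
       trace (Z t ** M1 t ** Z t ** M1 t) - trace (Z t ** M2 t)) (at t)"
    and "((\<lambda>t. trace (Z t ** M1 t ** Z t ** M1 t) - trace (Z t ** M2 t)) has_real_derivative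
       - 2 * trace (Z t ** M1 t ** Z t ** M1 t ** Z t ** M1 t)
       + 3 * trace (Z t ** M1 t ** Z t ** M2 t) - trace (Z t ** M3)) (at t)"
proof -
  have Z: "(Z has_vector_derivative - (Z t ** M1 t ** Z t)) (at t)"
    unfolding Z_def using has_vector_derivative_matrix_inv[OF M] d by simp
  show "((\<lambda>t. - ln (det (M t))) has_real_derivative - trace (Z t ** M1 t)) (at t)"
    unfolding Z_def by (intro DERIV_minus has_real_derivative_ln_det M d)
  have ZM1: "((\<lambda>t. Z t ** M1 t) has_vector_derivative Z t ** M2 t - Z t ** M1 t ** Z t ** M1 t) (at t)"
    using has_vd_matrix_mult[OF Z M1] by (simp add: matrix_mult_simps)
  have ZM2: "((\<lambda>t. Z t ** M2 t) has_vector_derivative Z t ** M3 - Z t ** M1 t ** Z t ** M2 t) (at t)"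
    using has_vd_matrix_mult[OF Z M2] by (simp add: matrix_mult_simps)
  show "((\<lambda>t. - trace (Z t ** M1 t)) has_real_derivative
       trace (Z t ** M1 t ** Z t ** M1 t) - trace (Z t ** M2 t)) (at t)"
    using DERIV_minus[OF has_real_derivative_trace[OF ZM1]] by (simp add: trace_sub)
  have sq: "((\<lambda>t. Z t ** M1 t ** Z t ** M1 t) has_vector_derivative
      (Z t ** M1 t) ** (Z t ** M2 t) - (Z t ** M1 t) ** (Z t ** M1 t ** Z t ** M1 t)
      + ((Z t ** M2 t) ** (Z t ** M1 t) - (Z t ** M1 t ** Z t ** M1 t) ** (Z t ** M1 t))) (at t)"
    using has_vd_matrix_mult[OF ZM1 ZM1] by (simp add: matrix_mult_simps matrix_mul_assoc)
  \<comment> \<open>Cyclicity merges the two mixed terms from the square. Together with the one from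
    differentiating \<open>Z\<close> in the subtracted trace they give the coefficient 3.\<close>
  have "trace ((Z t ** M2 t) ** (Z t ** M1 t)) = trace ((Z t ** M1 t) ** (Z t ** M2 t))"
    by (rule trace_mul_sym)
  then show "((\<lambda>t. trace (Z t ** M1 t ** Z t ** M1 t) - trace (Z t ** M2 t)) has_real_derivative
       - 2 * trace (Z t ** M1 t ** Z t ** M1 t ** Z t ** M1 t)
       + 3 * trace (Z t ** M1 t ** Z t ** M2 t) - trace (Z t ** M3)) (at t)"
    using DERIV_diff[OF has_real_derivative_trace[OF sq] has_real_derivative_trace[OF ZM2]]
    unfolding trace_sub trace_add matrix_mul_assoc by (simp add: algebra_simps)
qed

text \<open>The derivative of \<open>Y ** matrix_inv X\<close> in direction \<open>(H, V)\<close> is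
  this matrix times \<open>matrix_inv X\<close>.\<close>

definition schur_dir :: "real^'n^'n \<Rightarrow> real^'n^'n \<Rightarrow> real^'n^'n \<Rightarrow> real^'n^'n \<Rightarrow> real^'n^'n" where
  "schur_dir X Y H V = V - Y ** matrix_inv X ** H"

definition schur1 :: "real^'n^'n \<Rightarrow> real^'n^'n \<Rightarrow> real^'n^'n \<Rightarrow> real^'n^'n \<Rightarrow> real^'n^'n" where
  "schur1 X Y H V = H - V ** matrix_inv X ** transpose Y - Y ** matrix_inv X ** transpose V
     + Y ** matrix_inv X ** H ** matrix_inv X ** transpose Y"

definition schur2 :: "real^'n^'n \<Rightarrow> real^'n^'n \<Rightarrow> real^'n^'n \<Rightarrow> real^'n^'n \<Rightarrow> real^'n^'n" where
  "schur2 X Y H V =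
     (- 2) *\<^sub>R (schur_dir X Y H V ** matrix_inv X ** transpose (schur_dir X Y H V))"

definition schur3 :: "real^'n^'n \<Rightarrow> real^'n^'n \<Rightarrow> real^'n^'n \<Rightarrow> real^'n^'n \<Rightarrow> real^'n^'n" where
  "schur3 X Y H V = 6 *\<^sub>R
     (schur_dir X Y H V ** matrix_inv X ** H ** matrix_inv X ** transpose (schur_dir X Y H V))"

lemma has_vd_line: "((\<lambda>t. A + t *\<^sub>R B) has_vector_derivative B) (at t)"
  by (auto intro!: derivative_eq_intros)

text \<open>The terms of the second derivative collect into a single product around
  \<open>schur_dir\<close>; differentiating that product rather than its expansion keeps the third
  derivative short.\<close>

lemma schur_derivatives:
  fixes X0 Y0 H V :: "real^'n^'n"
  defines "X \<equiv> \<lambda>t. X0 + t *\<^sub>R H" and "Y \<equiv> \<lambda>t. Y0 + t *\<^sub>R V"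
  assumes pd: "pd_mat (X t)" and H: "transpose H = H"
  shows "((\<lambda>t. schur (X t) (Y t)) has_vector_derivative schur1 (X t) (Y t) H V) (at t)"
    and "((\<lambda>t. schur1 (X t) (Y t) H V) has_vector_derivative schur2 (X t) (Y t) H V) (at t)"
    and "((\<lambda>t. schur2 (X t) (Y t) H V) has_vector_derivative schur3 (X t) (Y t) H V) (at t)"
proof -
  have dX: "(X has_vector_derivative H) (at t)" and dY: "(Y has_vector_derivative V) (at t)"
    unfolding X_def Y_def by (rule has_vd_line)+
  define I where "I t = matrix_inv (X t)" for t
  have symI: "transpose (I t) = I t"
    unfolding I_def using transpose_matrix_inv[of "X t"] pd_mat_det_pos[OF pd] pd_mat_sym[OF pd] by simp
  have dI: "(I has_vector_derivative - (I t ** H ** I t)) (at t)"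
    unfolding I_def using has_vector_derivative_matrix_inv[OF dX] pd_mat_det_pos[OF pd] by simp
  note dYT = has_vd_transpose[OF dY]
  have const: "((\<lambda>t. A) has_vector_derivative 0) (at t)" for A :: "real^'n^'n" by simp
  note rules = has_vd_matrix_mult dI dX dY dYT const has_vector_derivative_diff has_vector_derivative_add
  show "((\<lambda>t. schur (X t) (Y t)) has_vector_derivative schur1 (X t) (Y t) H V) (at t)"
    unfolding schur_def schur1_def I_def[symmetric]
    by (rule has_vector_derivative_eq_rhs, (rule rules)+)
      (simp add: matrix_mult_simps matrix_mul_assoc)
  show "((\<lambda>t. schur1 (X t) (Y t) H V) has_vector_derivative schur2 (X t) (Y t) H V) (at t)"
    unfolding schur1_def schur2_def schur_dir_def I_def[symmetric]
    by (rule has_vector_derivative_eq_rhs, (rule rules)+)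
      (simp only: matrix_mult_simps matrix_mul_assoc H symI transpose_diff matrix_transpose_mul,
        simp add: scaleR_2 algebra_simps)
  define W where "W t = schur_dir (X t) (Y t) H V" for t
  have dW: "(W has_vector_derivative - (W t ** I t ** H)) (at t)"
    unfolding W_def schur_dir_def I_def[symmetric]
    by (rule has_vector_derivative_eq_rhs, (rule rules)+)
      (simp add: matrix_mult_simps matrix_mul_assoc)
  \<comment> \<open>Each of the three factors contributes the same term with a minus sign, hence the
    coefficient -3; the factor -2 in \<open>schur2\<close> turns it into 6.\<close>
  have "((\<lambda>t. W t ** I t ** transpose (W t)) has_vector_derivative
      (- 3) *\<^sub>R (W t ** I t ** H ** I t ** transpose (W t))) (at t)"
    by (rule has_vector_derivative_eq_rhs, (rule rules dW has_vd_transpose[OF dW])+)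
      (simp only: matrix_mult_simps matrix_mul_assoc transpose_minus matrix_transpose_mul H symI,
        simp add: vec_eq_iff)
  from bounded_linear.has_vector_derivative[OF bounded_linear_scaleR_right this, of "- 2"]
  show "((\<lambda>t. schur2 (X t) (Y t) H V) has_vector_derivative schur3 (X t) (Y t) H V) (at t)"
    unfolding schur2_def schur3_def W_def I_def by simp
qed

subsection \<open>Bounds on the derivatives\<close>

lemma trace_congruence:
  "trace (transpose Q ** Q ** B) = trace (Q ** B ** transpose (Q :: real^'n^'n))"
  using trace_mul_sym[of "transpose Q" "Q ** B"] by (simp add: matrix_mul_assoc)

text \<open>By symmetry the trace is the inner product of \<open>A\<close> with
  \<open>A ** A\<close>, so Cauchy-Schwarz and submultiplicativity apply.\<close>

lemma trace_cube_le:
  fixes A :: "real^'n^'n"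
  assumes "transpose A = A"
  shows "\<bar>trace (A ** A ** A)\<bar> \<le> norm A ^ 3"
proof -
  have "trace (A ** A ** A) = A \<bullet> (A ** A)"
    by (simp add: inner_matrix_eq_trace assms matrix_mul_assoc)
  then have "\<bar>trace (A ** A ** A)\<bar> \<le> norm A * norm (A ** A)"
    by (simp add: Cauchy_Schwarz_ineq2)
  also have "\<dots> \<le> norm A * (norm A * norm A)"
    by (intro mult_left_mono norm_matrix_mult_le) auto
  finally show ?thesis by (simp add: power3_eq_cube mult.assoc)
qed

text \<open>Cyclicity turns the trace into the inner product of \<open>N\<close> with
  \<open>A ** N\<close>.\<close>

lemma trace_mult_gram_le:
  fixes A N :: "real^'n^'n"
  shows "\<bar>trace (A ** N ** transpose N)\<bar> \<le> norm A * (norm N)\<^sup>2"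
proof -
  have "trace (A ** N ** transpose N) = N \<bullet> (A ** N)"
    unfolding inner_matrix_eq_trace by (rule trace_mul_sym)
  then have "\<bar>trace (A ** N ** transpose N)\<bar> \<le> norm N * norm (A ** N)"
    by (simp add: Cauchy_Schwarz_ineq2)
  also have "\<dots> \<le> norm N * (norm A * norm N)"
    by (intro mult_left_mono norm_matrix_mult_le) auto
  finally show ?thesis by (simp add: power2_eq_square algebra_simps)
qed

lemma trace_conj_le:
  fixes G N :: "real^'n^'n"
  shows "\<bar>trace (N ** G ** transpose N)\<bar> \<le> norm G * (norm N)\<^sup>2"
proof -
  have "trace (N ** G ** transpose N) = N \<bullet> (N ** G)"
    unfolding inner_matrix_eq_trace by (rule trace_mul_sym)
  then have "\<bar>trace (N ** G ** transpose N)\<bar> \<le> norm N * norm (N ** G)"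
    by (simp add: Cauchy_Schwarz_ineq2)
  also have "\<dots> \<le> norm N * (norm N * norm G)"
    by (intro mult_left_mono norm_matrix_mult_le) auto
  finally show ?thesis by (simp add: power2_eq_square algebra_simps)
qed

text \<open>\<open>phi1\<close>, \<open>phi2\<close> and \<open>phi3\<close> are the first three
  derivatives of \<open>- ln (det M)\<close> along a curve, as functions of the values of
  \<open>M\<close> and its derivatives at one point. This separates the estimates from the
  calculus.\<close>

definition phi1 :: "real^'n^'n \<Rightarrow> real^'n^'n \<Rightarrow> real" where
  "phi1 M M1 = - trace (matrix_inv M ** M1)"

definition phi2 :: "real^'n^'n \<Rightarrow> real^'n^'n \<Rightarrow> real^'n^'n \<Rightarrow> real" where
  "phi2 M M1 M2 = trace (matrix_inv M ** M1 ** matrix_inv M ** M1) - trace (matrix_inv M ** M2)"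

definition phi3 :: "real^'n^'n \<Rightarrow> real^'n^'n \<Rightarrow> real^'n^'n \<Rightarrow> real^'n^'n \<Rightarrow> real" where
  "phi3 M M1 M2 M3 =
     - 2 * trace (matrix_inv M ** M1 ** matrix_inv M ** M1 ** matrix_inv M ** M1)
     + 3 * trace (matrix_inv M ** M1 ** matrix_inv M ** M2) - trace (matrix_inv M ** M3)"

text \<open>Conjugation by \<open>Q\<close> normalises \<open>M\<close> to the identity, and
  cyclicity absorbs every inverse into the conjugated matrices.\<close>

lemma phi_traces:
  fixes M M1 Q :: "real^'n^'n"
  assumes Q: "Q ** M ** transpose Q = mat 1" and M1: "transpose M1 = M1"
  defines "A \<equiv> Q ** M1 ** transpose Q"
  shows "transpose A = A"
    and "phi1 M M1 = - trace A"
    and "phi2 M M1 M2 = (norm A)\<^sup>2 - trace (Q ** M2 ** transpose Q)"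
    and "phi3 M M1 M2 M3 = - 2 * trace (A ** A ** A)
       + 3 * trace (A ** (Q ** M2 ** transpose Q)) - trace (Q ** M3 ** transpose Q)"
proof -
  note inv = congruent_one_inv[OF Q]
  show A: "transpose A = A"
    by (simp add: A_def matrix_transpose_mul M1 matrix_mul_assoc)
  show "phi1 M M1 = - trace A"
    by (simp add: phi1_def inv A_def trace_congruence)
  have "(norm A)\<^sup>2 = trace (A ** A)"
    by (simp add: power2_norm_eq_inner inner_matrix_eq_trace A)
  moreover have "trace (matrix_inv M ** M1 ** matrix_inv M ** M1) = trace (A ** A)"
    using trace_congruence[of Q "M1 ** transpose Q ** Q ** M1"]
    by (simp add: inv A_def matrix_mul_assoc)
  ultimately show "phi2 M M1 M2 = (norm A)\<^sup>2 - trace (Q ** M2 ** transpose Q)"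
    by (simp add: phi2_def inv trace_congruence)
  have "trace (matrix_inv M ** M1 ** matrix_inv M ** M1 ** matrix_inv M ** M1) = trace (A ** A ** A)"
    using trace_congruence[of Q "M1 ** transpose Q ** Q ** M1 ** transpose Q ** Q ** M1"]
    by (simp add: inv A_def matrix_mul_assoc)
  moreover have "trace (matrix_inv M ** M1 ** matrix_inv M ** M2)
      = trace (A ** (Q ** M2 ** transpose Q))"
    using trace_congruence[of Q "M1 ** transpose Q ** Q ** M2"]
    by (simp add: inv A_def matrix_mul_assoc)
  ultimately show "phi3 M M1 M2 M3 = - 2 * trace (A ** A ** A)
       + 3 * trace (A ** (Q ** M2 ** transpose Q)) - trace (Q ** M3 ** transpose Q)"
    by (simp add: phi3_def inv trace_congruence)
qed

text \<open>The term for \<open>X\<close> itself: it moves along a straight line, so its second and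
  third derivatives are 0.\<close>

lemma ln_det_line_bounds:
  fixes X H R :: "real^'n^'n"
  assumes R: "R ** X ** transpose R = mat 1" and H: "transpose H = H"
  defines "g \<equiv> norm (R ** H ** transpose R)"
  shows "(phi1 X H)\<^sup>2 \<le> real CARD('n) * g\<^sup>2"
    and "phi2 X H 0 = g\<^sup>2"
    and "\<bar>phi3 X H 0 0\<bar> \<le> 2 * g ^ 3"
proof -
  have z: "R ** 0 ** transpose R = 0" "trace (0 :: real^'n^'n) = 0"
      "A ** 0 = 0" for A :: "real^'n^'n"
    by (simp_all add: trace_def matrix_matrix_mult_def vec_eq_iff)
  note phi = phi_traces[OF R H]
  show "(phi1 X H)\<^sup>2 \<le> real CARD('n) * g\<^sup>2"
    using trace_sq_le by (simp add: phi(2) g_def)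
  show "phi2 X H 0 = g\<^sup>2" by (simp add: phi(3) g_def z)
  show "\<bar>phi3 X H 0 0\<bar> \<le> 2 * g ^ 3"
    using trace_cube_le[OF phi(1)] by (simp add: phi(4) g_def z abs_mult)
qed

lemma schur1_sym:
  assumes X: "pd_mat X" and H: "transpose H = H"
  shows "transpose (schur1 X Y H V) = schur1 X Y H V"
proof -
  have "transpose (matrix_inv X) = matrix_inv X"
    using transpose_matrix_inv[of X] pd_mat_det_pos[OF X] pd_mat_sym[OF X] by simp
  then show ?thesis
    by (simp add: schur1_def transpose_add transpose_diff matrix_transpose_mul H matrix_mul_assoc)
qed

text \<open>With \<open>A = Q S' Q\<^sup>T\<close>, \<open>N = Q W R\<^sup>T\<close> and \<open>G = R H R\<^sup>T\<close>, the second and third derivatives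
  of \<open>- ln det S\<close> are \<open>tr A\<^sup>2 + 2 tr N N\<^sup>T\<close> and \<open>- 2 tr A\<^sup>3 - 6 tr A N N\<^sup>T - 6 tr N G N\<^sup>T\<close>.\<close>

lemma ln_det_schur_bounds:
  fixes X Y H V R :: "real^'n^'n"
  assumes R: "R ** X ** transpose R = mat 1" and X: "pd_mat X" and H: "transpose H = H"
    and S: "pd_mat (schur X Y)"
  defines "g \<equiv> norm (R ** H ** transpose R)"
  obtains a b where "a \<ge> 0" "b \<ge> 0"
    "(phi1 (schur X Y) (schur1 X Y H V))\<^sup>2 \<le> real CARD('n) * a\<^sup>2"
    "phi2 (schur X Y) (schur1 X Y H V) (schur2 X Y H V) = a\<^sup>2 + 2 * b"
    "\<bar>phi3 (schur X Y) (schur1 X Y H V) (schur2 X Y H V) (schur3 X Y H V)\<bar>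
       \<le> 2 * a ^ 3 + 6 * (a * b) + 6 * (g * b)"
proof -
  obtain Q :: "real^'n^'n" where Q: "Q ** schur X Y ** transpose Q = mat 1"
    using pd_mat_congruent_one[OF S] .
  define A where "A = Q ** schur1 X Y H V ** transpose Q"
  define W where "W = schur_dir X Y H V"
  define N where "N = Q ** W ** transpose R"
  define G where "G = R ** H ** transpose R"
  note inv = congruent_one_inv[OF R]
  have S2: "Q ** schur2 X Y H V ** transpose Q = (- 2) *\<^sub>R (N ** transpose N)"
    by (simp add: schur2_def W_def[symmetric] N_def inv matrix_mult_simps matrix_transpose_mul matrix_mul_assoc)
  have S3: "Q ** schur3 X Y H V ** transpose Q = 6 *\<^sub>R (N ** G ** transpose N)"
    by (simp add: schur3_def W_def[symmetric] N_def G_def inv matrix_mult_simps matrix_transpose_mul matrix_mul_assoc)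
  note phi = phi_traces[OF Q schur1_sym[OF X H, of Y V], folded A_def]
  have NN: "trace (N ** transpose N) = (norm N)\<^sup>2"
    using trace_mul_sym[of N "transpose N"] by (simp add: power2_norm_eq_inner inner_matrix_eq_trace)
  show thesis
  proof (rule that[of "norm A" "(norm N)\<^sup>2"])
    show "(phi1 (schur X Y) (schur1 X Y H V))\<^sup>2 \<le> real CARD('n) * (norm A)\<^sup>2"
      using trace_sq_le by (simp add: phi(2))
    show "phi2 (schur X Y) (schur1 X Y H V) (schur2 X Y H V) = (norm A)\<^sup>2 + 2 * (norm N)\<^sup>2"
      by (simp add: phi(3) S2 trace_scaleR NN trace_minus)
    have "phi3 (schur X Y) (schur1 X Y H V) (schur2 X Y H V) (schur3 X Y H V)
      = - 2 * trace (A ** A ** A) - 6 * trace (A ** N ** transpose N) - 6 * trace (N ** G ** transpose N)"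
      unfolding phi(4) S2 S3 matrix_mult_simps trace_scaleR matrix_mul_assoc by simp
    then show "\<bar>phi3 (schur X Y) (schur1 X Y H V) (schur2 X Y H V) (schur3 X Y H V)\<bar>
       \<le> 2 * norm A ^ 3 + 6 * (norm A * (norm N)\<^sup>2) + 6 * (g * (norm N)\<^sup>2)"
      using trace_cube_le[OF phi(1)] trace_mult_gram_le[of A N] trace_conj_le[of N G]
      unfolding g_def G_def[symmetric] by linarith
  qed auto
qed

text \<open>With \<open>u = a + g\<close> and \<open>n\<^sup>2 = a\<^sup>2 + g\<^sup>2 + 2 b\<close> the claim is
  \<open>3 n\<^sup>2 u - u\<^sup>3 \<le> 2 n\<^sup>3\<close>, that is \<open>(n - u)\<^sup>2 (2 n + u) \<ge> 0\<close>.\<close>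

lemma self_concordance_scalar:
  fixes a b g :: real
  assumes "a \<ge> 0" "b \<ge> 0" "g \<ge> 0"
  shows "a ^ 3 + g ^ 3 + 3 * (a * b) + 3 * (g * b) \<le> (a\<^sup>2 + g\<^sup>2 + 2 * b) powr (3/2)"
proof -
  define n where "n = sqrt (a\<^sup>2 + g\<^sup>2 + 2 * b)"
  define u where "u = a + g"
  have n: "n \<ge> 0" "n\<^sup>2 = a\<^sup>2 + g\<^sup>2 + 2 * b" using assms by (auto simp: n_def)
  have "0 \<le> (n - u)\<^sup>2 * (2 * n + u)" using n(1) assms by (auto simp: u_def)
  also have "\<dots> = 2 * n ^ 3 - 3 * n\<^sup>2 * u + u ^ 3"
    by (simp add: power2_eq_square power3_eq_cube algebra_simps)
  finally have "3 * n\<^sup>2 * u - u ^ 3 \<le> 2 * n ^ 3" by simp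
  moreover have "3 * n\<^sup>2 * u - u ^ 3 = 2 * (a ^ 3 + g ^ 3 + 3 * (a * b) + 3 * (g * b))"
    unfolding n(2) u_def by (simp add: power2_eq_square power3_eq_cube algebra_simps)
  moreover have "(n\<^sup>2) powr (3/2) = n ^ 3"
  proof (cases "n = 0")
    case False
    then have "(n powr 2) powr (3/2) = n powr 3" by (simp add: powr_powr)
    then show ?thesis using False n(1) by (simp add: powr_numeral)
  qed simp
  ultimately show ?thesis by (simp add: n(2)[symmetric])
qed

text \<open>Each \<open>a i\<close> is at most the Euclidean norm of the family, so one factor of
  every cube can be replaced by that norm.\<close>

lemma sum_cube_le:
  fixes a :: "'k \<Rightarrow> real"
  assumes "finite I" "\<And>i. i \<in> I \<Longrightarrow> a i \<ge> 0"
  shows "(\<Sum>i\<in>I. a i ^ 3) \<le> sqrt (\<Sum>i\<in>I. (a i)\<^sup>2) ^ 3"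
proof -
  let ?s = "sqrt (\<Sum>i\<in>I. (a i)\<^sup>2)"
  have le: "a i \<le> ?s" if "i \<in> I" for i
    using member_le_sum[of i I "\<lambda>i. (a i)\<^sup>2"] assms that by (intro real_le_rsqrt) auto
  have "(\<Sum>i\<in>I. a i ^ 3) = (\<Sum>i\<in>I. a i * (a i)\<^sup>2)"
    by (simp add: power2_eq_square power3_eq_cube mult.assoc)
  also have "\<dots> \<le> (\<Sum>i\<in>I. ?s * (a i)\<^sup>2)"
    using le by (intro sum_mono mult_right_mono) auto
  also have "\<dots> = ?s * ?s\<^sup>2" by (simp add: sum_distrib_left sum_nonneg)
  also have "\<dots> = ?s ^ 3" by (simp only: power2_eq_square power3_eq_cube mult.assoc)
  finally show ?thesis .
qed

lemma sum_mult_le_sqrt_sum: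
  fixes a b :: "'k \<Rightarrow> real"
  assumes "finite I" "\<And>i. i \<in> I \<Longrightarrow> b i \<ge> 0"
  shows "(\<Sum>i\<in>I. a i * b i) \<le> sqrt (\<Sum>i\<in>I. (a i)\<^sup>2) * (\<Sum>i\<in>I. b i)"
proof -
  have le: "a i \<le> sqrt (\<Sum>i\<in>I. (a i)\<^sup>2)" if "i \<in> I" for i
    using member_le_sum[of i I "\<lambda>i. (a i)\<^sup>2"] assms that by (intro real_le_rsqrt) auto
  show ?thesis
    unfolding sum_distrib_left using le assms by (intro sum_mono mult_right_mono) auto
qed

definition Fhat1 :: "(real^'n^'n) \<times> (real^'n^'n^'k) \<Rightarrow> (real^'n^'n) \<times> (real^'n^'n^'k) \<Rightarrow> real" where
  "Fhat1 p h = (case (p, h) of ((X, Y), (H, V)) \<Rightarrow>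
     (\<Sum>i\<in>UNIV. phi1 (schur X (Y $ i)) (schur1 X (Y $ i) H (V $ i))) + phi1 X H)"

definition Fhat2 :: "(real^'n^'n) \<times> (real^'n^'n^'k) \<Rightarrow> (real^'n^'n) \<times> (real^'n^'n^'k) \<Rightarrow> real" where
  "Fhat2 p h = (case (p, h) of ((X, Y), (H, V)) \<Rightarrow>
     (\<Sum>i\<in>UNIV. phi2 (schur X (Y $ i)) (schur1 X (Y $ i) H (V $ i)) (schur2 X (Y $ i) H (V $ i)))
     + phi2 X H 0)"

definition Fhat3 :: "(real^'n^'n) \<times> (real^'n^'n^'k) \<Rightarrow> (real^'n^'n) \<times> (real^'n^'n^'k) \<Rightarrow> real" where
  "Fhat3 p h = (case (p, h) of ((X, Y), (H, V)) \<Rightarrow>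
     (\<Sum>i\<in>UNIV. phi3 (schur X (Y $ i)) (schur1 X (Y $ i) H (V $ i)) (schur2 X (Y $ i) H (V $ i))
        (schur3 X (Y $ i) H (V $ i))) + phi3 X H 0 0)"

text \<open>All blocks share \<open>X\<close> and \<open>H\<close>, hence a single \<open>R\<close>
  and \<open>g\<close>, while block \<open>i\<close> brings its own \<open>a i\<close> and
  \<open>b i\<close>. Collecting these into \<open>as\<close> and \<open>bs\<close> reduces the
  third-derivative bound to \<open>self_concordance_scalar\<close>.\<close>

lemma Fhat_bounds:
  fixes p h :: "(real^'n^'n) \<times> (real^'n^'n^'k)"
  assumes p: "p \<in> Fhat_dom" and h: "h \<in> amb_space"
  shows "Fhat2 p h \<ge> 0"
    and "\<bar>Fhat3 p h\<bar> \<le> 2 * Fhat2 p h powr (3/2)"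
    and "(Fhat1 p h)\<^sup>2 \<le> real (CARD('n) * (CARD('k) + 1)) * Fhat2 p h"
proof -
  obtain X Y where XY: "p = (X, Y)" by (cases p)
  obtain H V where HV: "h = (H, V)" by (cases h)
  have X: "pd_mat X" and S: "\<And>i. pd_mat (schur X (Y $ i))"
    using p by (auto simp: XY Fhat_dom_iff_schur)
  have H: "transpose H = H" using h by (simp add: HV amb_space_def sym_mat_def)
  obtain R :: "real^'n^'n" where R: "R ** X ** transpose R = mat 1"
    using pd_mat_congruent_one[OF X] .
  define g where "g = norm (R ** H ** transpose R)"
  define P1 where "P1 i = phi1 (schur X (Y $ i)) (schur1 X (Y $ i) H (V $ i))" for i
  define P2 where
    "P2 i = phi2 (schur X (Y $ i)) (schur1 X (Y $ i) H (V $ i)) (schur2 X (Y $ i) H (V $ i))" for i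
  define P3 where "P3 i = phi3 (schur X (Y $ i)) (schur1 X (Y $ i) H (V $ i))
      (schur2 X (Y $ i) H (V $ i)) (schur3 X (Y $ i) H (V $ i))" for i
  have "\<forall>i. \<exists>a b. a \<ge> 0 \<and> b \<ge> 0 \<and> (P1 i)\<^sup>2 \<le> real CARD('n) * a\<^sup>2 \<and> P2 i = a\<^sup>2 + 2 * b \<and>
      \<bar>P3 i\<bar> \<le> 2 * a ^ 3 + 6 * (a * b) + 6 * (g * b)"
  proof
    fix i
    show "\<exists>a b. a \<ge> 0 \<and> b \<ge> 0 \<and> (P1 i)\<^sup>2 \<le> real CARD('n) * a\<^sup>2 \<and> P2 i = a\<^sup>2 + 2 * b \<and>
      \<bar>P3 i\<bar> \<le> 2 * a ^ 3 + 6 * (a * b) + 6 * (g * b)"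
      using ln_det_schur_bounds[OF R X H S[of i], where V = "V $ i"]
      unfolding P1_def P2_def P3_def g_def by metis
  qed
  then obtain a b where a: "\<And>i. a i \<ge> 0" and b: "\<And>i. b i \<ge> 0"
    and P1: "\<And>i. (P1 i)\<^sup>2 \<le> real CARD('n) * (a i)\<^sup>2"
    and P2: "\<And>i. P2 i = (a i)\<^sup>2 + 2 * b i"
    and P3: "\<And>i. \<bar>P3 i\<bar> \<le> 2 * a i ^ 3 + 6 * (a i * b i) + 6 * (g * b i)"
    by metis
  note G = ln_det_line_bounds[OF R H, folded g_def]
  have g: "g \<ge> 0" by (simp add: g_def)
  define as where "as = sqrt (\<Sum>i\<in>UNIV. (a i)\<^sup>2)"
  define bs where "bs = (\<Sum>i\<in>UNIV. b i)"
  have as: "as \<ge> 0" "as\<^sup>2 = (\<Sum>i\<in>UNIV. (a i)\<^sup>2)" by (auto simp: as_def sum_nonneg)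
  have bs: "bs \<ge> 0" by (simp add: bs_def sum_nonneg b)
  have F2: "Fhat2 p h = as\<^sup>2 + g\<^sup>2 + 2 * bs"
    using G(2) by (simp add: Fhat2_def XY HV P2_def[symmetric] P2 sum.distrib as(2) bs_def sum_distrib_left)
  show F2_nonneg: "Fhat2 p h \<ge> 0" unfolding F2 using bs by simp
  have "\<bar>Fhat3 p h\<bar> \<le> (\<Sum>i\<in>UNIV. \<bar>P3 i\<bar>) + 2 * g ^ 3"
  proof -
    have "Fhat3 p h = sum P3 UNIV + phi3 X H 0 0" by (simp add: Fhat3_def XY HV P3_def)
    moreover have "\<bar>sum P3 UNIV\<bar> \<le> (\<Sum>i\<in>UNIV. \<bar>P3 i\<bar>)" by (rule sum_abs)
    ultimately show ?thesis using G(3) by linarith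
  qed
  also have "(\<Sum>i\<in>UNIV. \<bar>P3 i\<bar>) \<le> (\<Sum>i\<in>UNIV. 2 * a i ^ 3 + 6 * (a i * b i) + 6 * (g * b i))"
    by (intro sum_mono P3)
  also have "\<dots> = 2 * (\<Sum>i\<in>UNIV. a i ^ 3) + 6 * (\<Sum>i\<in>UNIV. a i * b i) + 6 * (g * bs)"
    by (simp add: sum.distrib sum_distrib_left bs_def)
  also have "\<dots> \<le> 2 * as ^ 3 + 6 * (as * bs) + 6 * (g * bs)"
    using sum_cube_le[of UNIV a] sum_mult_le_sqrt_sum[of UNIV b a] a b
    by (simp add: as_def bs_def add_mono)
  finally show "\<bar>Fhat3 p h\<bar> \<le> 2 * Fhat2 p h powr (3/2)"
    using self_concordance_scalar[OF as(1) bs g] by (simp add: F2)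
  \<comment> \<open>The index \<open>None\<close> stands for the term of \<open>X\<close>, so there
    are \<open>CARD('k) + 1\<close> summands. Cauchy-Schwarz against the constant 1 produces this
    number as the factor m of the parameter.\<close>
  define c where "c j = (case j of None \<Rightarrow> phi1 X H | Some i \<Rightarrow> P1 i)" for j :: "'k option"
  have split: "(\<Sum>j\<in>UNIV. f j) = f None + (\<Sum>i\<in>UNIV. f (Some i))" for f :: "'k option \<Rightarrow> real"
    by (simp add: UNIV_option_conv sum.reindex)
  have "(Fhat1 p h)\<^sup>2 = (\<Sum>j\<in>UNIV. c j)\<^sup>2"
    by (simp add: Fhat1_def XY HV P1_def[symmetric] split c_def add.commute)
  also have "\<dots> \<le> (\<Sum>j\<in>UNIV. (c j)\<^sup>2) * (\<Sum>j\<in>(UNIV :: 'k option set). 1\<^sup>2)"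
    using Cauchy_Schwarz_ineq_sum[of c "\<lambda>_. 1" UNIV] by simp
  also have "\<dots> = real (CARD('k) + 1) * ((phi1 X H)\<^sup>2 + (\<Sum>i\<in>UNIV. (P1 i)\<^sup>2))"
    by (simp add: split c_def)
  also have "\<dots> \<le> real (CARD('k) + 1) * (real CARD('n) * g\<^sup>2 + (\<Sum>i\<in>UNIV. real CARD('n) * (a i)\<^sup>2))"
    using G(1) P1 by (intro mult_left_mono add_mono sum_mono) auto
  also have "\<dots> = real (CARD('n) * (CARD('k) + 1)) * (g\<^sup>2 + as\<^sup>2)"
    by (simp add: as(2) sum_distrib_left[symmetric] algebra_simps)
  also have "\<dots> \<le> real (CARD('n) * (CARD('k) + 1)) * Fhat2 p h"
    unfolding F2 using bs by (intro mult_left_mono) auto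
  finally show "(Fhat1 p h)\<^sup>2 \<le> real (CARD('n) * (CARD('k) + 1)) * Fhat2 p h" .
qed

subsection \<open>The barrier\<close>

lemma Fhat_line_derivatives:
  fixes p h :: "(real^'n^'n) \<times> (real^'n^'n^'k)"
  assumes p: "p + t *\<^sub>R h \<in> Fhat_dom" and h: "h \<in> amb_space"
  shows "((\<lambda>t. Fhat (p + t *\<^sub>R h)) has_real_derivative Fhat1 (p + t *\<^sub>R h) h) (at t)"
    and "((\<lambda>t. Fhat1 (p + t *\<^sub>R h) h) has_real_derivative Fhat2 (p + t *\<^sub>R h) h) (at t)"
    and "((\<lambda>t. Fhat2 (p + t *\<^sub>R h) h) has_real_derivative Fhat3 (p + t *\<^sub>R h) h) (at t)"
proof -
  obtain X0 Y0 where XY: "p = (X0, Y0)" by (cases p)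
  obtain H V where HV: "h = (H, V)" by (cases h)
  have H: "transpose H = H" using h by (simp add: HV amb_space_def sym_mat_def)
  define X where "X t = X0 + t *\<^sub>R H" for t
  define Y where "Y i t = Y0 $ i + t *\<^sub>R V $ i" for i t
  have line: "p + t *\<^sub>R h = (X t, Y0 + t *\<^sub>R V)" "(Y0 + t *\<^sub>R V) $ i = Y i t" for t i
    by (simp_all add: XY HV X_def Y_def)
  have X: "pd_mat (X t)" and S: "pd_mat (schur (X t) (Y i t))" for i
    using p by (auto simp: line(1) line(2)[symmetric] Fhat_dom_iff_schur simp del: vector_add_component)
  have dX: "(X has_vector_derivative H) (at t)"
    unfolding X_def by (rule has_vd_line)
  note dS = schur_derivatives[of X0 t H "Y0 $ i" "V $ i" for i, folded X_def Y_def, OF X H]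
  \<comment> \<open>Along the line \<open>X\<close> has constant derivative \<open>H\<close> and
    vanishing higher derivatives.\<close>
  note ld_X = ln_det_derivatives[where M = X and ?M1.0 = "\<lambda>_. H" and ?M2.0 = "\<lambda>_. 0" and ?M3.0 = 0,
      OF pd_mat_det_pos[OF X] dX has_vector_derivative_const has_vector_derivative_const]
  note ld_S = ln_det_derivatives[where M = "\<lambda>t. schur (X t) (Y i t)"
      and ?M1.0 = "\<lambda>t. schur1 (X t) (Y i t) H (V $ i)" and ?M2.0 = "\<lambda>t. schur2 (X t) (Y i t) H (V $ i)"
      for i, OF pd_mat_det_pos[OF S] dS]
  show "((\<lambda>t. Fhat (p + t *\<^sub>R h)) has_real_derivative Fhat1 (p + t *\<^sub>R h) h) (at t)"
  proof -
    have "((\<lambda>t. (\<Sum>i\<in>UNIV. - ln (det (schur (X t) (Y i t)))) + - ln (det (X t)))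
        has_real_derivative Fhat1 (p + t *\<^sub>R h) h) (at t)"
      unfolding line(1) unfolding Fhat1_def phi1_def HV prod.case unfolding line(2)
      by (intro DERIV_add DERIV_sum ld_S(1) ld_X(1))
    then show ?thesis by (simp add: line(1) line(2)[symmetric] Fhat_eq sum_negf del: vector_add_component)
  qed
  show "((\<lambda>t. Fhat1 (p + t *\<^sub>R h) h) has_real_derivative Fhat2 (p + t *\<^sub>R h) h) (at t)"
    unfolding line(1) unfolding Fhat1_def Fhat2_def phi1_def phi2_def HV prod.case unfolding line(2)
    by (intro DERIV_add DERIV_sum ld_S(2) ld_X(2))
  show "((\<lambda>t. Fhat2 (p + t *\<^sub>R h) h) has_real_derivative Fhat3 (p + t *\<^sub>R h) h) (at t)"
    unfolding line(1) unfolding Fhat2_def Fhat3_def phi2_def phi3_def HV prod.case unfolding line(2)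
    by (intro DERIV_add DERIV_sum ld_S(3) ld_X(3))
qed

lemma smooth_on_Fhat:
  "smooth_on n Fhat (Fhat_dom :: ((real^'n^'n) \<times> (real^'n^'n^'k)) set)"
proof -
  let ?U = "Fhat_dom :: ((real^'n^'n) \<times> (real^'n^'n^'k)) set"
  have X: "smooth_on n fst ?U"
    by (rule smooth_on_bounded_linear[OF bounded_linear_fst smooth_on_id])
  have Y: "smooth_on n (\<lambda>p. snd p $ i) ?U" for i
    by (rule smooth_on_bounded_linear[OF
          bounded_linear_compose[OF bounded_linear_vec_nth bounded_linear_snd] smooth_on_id])
  have pd: "pd_mat (fst p)" "pd_mat (schur (fst p) (snd p $ i))" if "p \<in> ?U" for p i
    using that by (cases p; simp add: Fhat_dom_iff_schur)+
  have S: "smooth_on n (\<lambda>p. schur (fst p) (snd p $ i)) ?U" for i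
    unfolding schur_def
    by (intro smooth_on_diff smooth_on_matrix_mult X Y smooth_on_matrix_inv
        smooth_on_bounded_linear[OF bounded_linear_transpose])
      (use pd_mat_det_pos[OF pd(1)] in force)
  have "smooth_on n (\<lambda>p. - (\<Sum>i\<in>UNIV. ln (det (schur (fst p) (snd p $ i)))) - ln (det (fst p))) ?U"
    by (intro smooth_on_diff smooth_on_minus smooth_on_sum smooth_on_ln_det S X)
      (auto intro: pd_mat_det_pos pd)
  then show ?thesis
    by (rule smooth_on_cong[rotated]) (auto simp: Fhat_eq)
qed

text \<open>Restricted to a segment in the convex domain, the function has second derivative
  \<open>Fhat2\<close>, which is nonnegative by \<open>Fhat_bounds\<close>.\<close>

lemma convex_on_Fhat:
  "convex_on (Fhat_dom :: ((real^'n^'n) \<times> (real^'n^'n^'k)) set) Fhat"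
proof (rule convex_onI[OF _ convex_Fhat_dom])
  fix s :: real and p q :: "(real^'n^'n) \<times> (real^'n^'n^'k)"
  assume s: "0 < s" "s < 1" and pq: "p \<in> Fhat_dom" "q \<in> Fhat_dom"
  define h where "h = q - p"
  have h: "h \<in> amb_space"
    using pq Fhat_dom_subset_amb subspace_diff[OF subspace_amb_space] unfolding h_def by blast
  have seg: "p + t *\<^sub>R h \<in> Fhat_dom" if "t \<in> {0..1}" for t
  proof -
    have "(1 - t) *\<^sub>R p + t *\<^sub>R q \<in> Fhat_dom"
      using convexD_alt[OF convex_Fhat_dom pq(1) pq(2)] that by simp
    then show ?thesis by (simp add: h_def algebra_simps)
  qed
  have "convex_on {0..1} (\<lambda>t. Fhat (p + t *\<^sub>R h))"
    by (rule f''_ge0_imp_convex[OF _ Fhat_line_derivatives(1,2)]) (auto simp: seg h Fhat_bounds(1))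
  from convex_onD[OF this, of s 0 1] s
  show "Fhat ((1 - s) *\<^sub>R p + s *\<^sub>R q) \<le> (1 - s) * Fhat p + s * Fhat q"
    by (simp add: h_def algebra_simps)
qed

text \<open>A derivative within \<open>S\<close> suffices for a two-sided derivative along the line,
  because the line stays in \<open>S\<close> for all parameters in the open set
  \<open>T\<close>.\<close>

lemma has_real_derivative_line:
  fixes f :: "'a::real_normed_vector \<Rightarrow> real"
  assumes f: "(f has_derivative f') (at (x + t *\<^sub>R h) within S)"
    and T: "open T" "t \<in> T" "\<And>r. r \<in> T \<Longrightarrow> x + r *\<^sub>R h \<in> S"
  shows "((\<lambda>r. f (x + r *\<^sub>R h)) has_real_derivative f' h) (at t)"
proof -
  have "((\<lambda>r. x + r *\<^sub>R h) has_derivative (\<lambda>r. r *\<^sub>R h)) (at t within T)"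
    by (auto intro!: derivative_eq_intros)
  then have "((\<lambda>r. f (x + r *\<^sub>R h)) has_derivative (\<lambda>r. f' (r *\<^sub>R h))) (at t within T)"
    by (rule has_derivative_in_compose) (auto intro: has_derivative_subset[OF f] T(3))
  moreover have "f' (r *\<^sub>R h) = f' h * r" for r
    using linear_scale[OF has_derivative_linear[OF f]] by simp
  ultimately show ?thesis
    using T by (simp add: has_field_derivative_def at_within_open[of t T])
qed

text \<open>The derivatives of \<open>F\<close> on the diagonal are read off its restriction to lines.\<close>

lemma diagonal_derivatives_eq:
  fixes F :: "'a::euclidean_space \<Rightarrow> real"
  assumes U: "openin (top_of_set V) U" and V: "subspace V" and x: "x \<in> U" and h: "h \<in> V"
    and D1: "\<And>y. y \<in> U \<Longrightarrow> (F has_derivative blinfun_apply (D1 y)) (at y within U)"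
    and D2: "\<And>y. y \<in> U \<Longrightarrow> (D1 has_derivative blinfun_apply (D2 y)) (at y within U)"
    and D3: "\<And>y. y \<in> U \<Longrightarrow> (D2 has_derivative blinfun_apply (D3 y)) (at y within U)"
    and F1: "\<And>t. x + t *\<^sub>R h \<in> U \<Longrightarrow> ((\<lambda>t. F (x + t *\<^sub>R h)) has_real_derivative F1 t) (at t)"
    and F2: "\<And>t. x + t *\<^sub>R h \<in> U \<Longrightarrow> (F1 has_real_derivative F2 t) (at t)"
    and F3: "\<And>t. x + t *\<^sub>R h \<in> U \<Longrightarrow> (F2 has_real_derivative F3 t) (at t)"
  shows "D1 x h = F1 0" "D2 x h h = F2 0" "D3 x h h h = F3 0"
proof -
  \<comment> \<open>These parameters form an open set because the line runs inside \<open>V\<close>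
    and \<open>U\<close> is open relative to \<open>V\<close>.\<close>
  define T where "T = {t. x + t *\<^sub>R h \<in> U}"
  have "openin (top_of_set UNIV) (UNIV \<inter> (\<lambda>t. x + t *\<^sub>R h) -` U)"
  proof (rule continuous_openin_preimage[OF _ _ U])
    show "continuous_on UNIV (\<lambda>t. x + t *\<^sub>R h)" by (intro continuous_intros)
    have "x \<in> V" using U x openin_imp_subset by blast
    then show "(\<lambda>t. x + t *\<^sub>R h) \<in> UNIV \<rightarrow> V"
      using V h by (auto simp: subspace_add subspace_scale)
  qed
  then have T: "open T" by (simp add: T_def vimage_def)
  have T0: "0 \<in> T" using x by (simp add: T_def)
  have TU: "\<And>r. r \<in> T \<Longrightarrow> x + r *\<^sub>R h \<in> U" by (simp add: T_def)
  have cong: "(f has_real_derivative d) (at t)"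
    if "(g has_real_derivative d) (at t)" "t \<in> T" "\<And>r. r \<in> T \<Longrightarrow> f r = g r" for f g d t
    using has_field_derivative_transform_within_open[OF that(1) T that(2)] that(3) by auto
  have e1: "D1 (x + t *\<^sub>R h) h = F1 t" if "t \<in> T" for t
    using DERIV_unique[OF has_real_derivative_line[OF D1 T that TU] F1] TU[OF that] by blast
  have e2: "D2 (x + t *\<^sub>R h) h h = F2 t" if "t \<in> T" for t
  proof -
    have "((\<lambda>y. D1 y h) has_derivative (\<lambda>k. D2 (x + t *\<^sub>R h) k h)) (at (x + t *\<^sub>R h) within U)"
      using bounded_linear.has_derivative[OF blinfun.bounded_linear_left D2[OF TU[OF that]]] .
    from has_real_derivative_line[OF this T that TU]
    have "((\<lambda>r. D1 (x + r *\<^sub>R h) h) has_real_derivative D2 (x + t *\<^sub>R h) h h) (at t)" .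
    \<comment> \<open>The previous order identifies the two functions on all of the open set
      \<open>T\<close>, not only at \<open>t\<close>, so their derivatives agree as well.\<close>
    from cong[OF this that, of F1] e1
    have "(F1 has_real_derivative D2 (x + t *\<^sub>R h) h h) (at t)" by simp
    then show ?thesis using DERIV_unique F2[OF TU[OF that]] by blast
  qed
  have e3: "D3 (x + t *\<^sub>R h) h h h = F3 t" if "t \<in> T" for t
  proof -
    have "((\<lambda>y. D2 y h h) has_derivative (\<lambda>k. D3 (x + t *\<^sub>R h) k h h)) (at (x + t *\<^sub>R h) within U)"
      using bounded_linear.has_derivative[OF bounded_linear_compose[OF blinfun.bounded_linear_left
            blinfun.bounded_linear_left] D3[OF TU[OF that]]] by (simp add: o_def)
    from has_real_derivative_line[OF this T that TU]
    have "((\<lambda>r. D2 (x + r *\<^sub>R h) h h) has_real_derivative D3 (x + t *\<^sub>R h) h h h) (at t)" .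
    from cong[OF this that, of F2] e2
    have "(F2 has_real_derivative D3 (x + t *\<^sub>R h) h h h) (at t)" by simp
    then show ?thesis using DERIV_unique F3[OF TU[OF that]] by blast
  qed
  show "D1 x h = F1 0" "D2 x h h = F2 0" "D3 x h h h = F3 0"
    using e1[OF T0] e2[OF T0] e3[OF T0] by simp_all
qed

text \<open>With L = \<open>CARD('n)\<close> and m - 1 = \<open>CARD('k)\<close> the parameter is L
  m. Smoothness supplies the operator-valued derivatives, whose diagonal values in directions of
  \<open>amb_space\<close> are \<open>Fhat1\<close>, \<open>Fhat2\<close> and \<open>Fhat3\<close>,
  so \<open>Fhat_bounds\<close> applies to them.\<close>

theorem mainTheorem5:
  shows "sc_barrier (amb_space :: ((real^'n^'n) \<times> (real^'n^'n^'k)) set) Km_linf Fhat_dom Fhat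
           (real (CARD('n) * (CARD('k) + 1)))"
proof -
  let ?U = "Fhat_dom :: ((real^'n^'n) \<times> (real^'n^'n^'k)) set"
  let ?V = "amb_space :: ((real^'n^'n) \<times> (real^'n^'n^'k)) set"
  \<comment> \<open>Starting from order 3, each extraction of a derivative lowers the order by one,
    which leaves \<open>D3\<close> continuous.\<close>
  obtain D1 where D1: "\<And>x. x \<in> ?U \<Longrightarrow> (Fhat has_derivative blinfun_apply (D1 x)) (at x within ?U)"
      and s1: "smooth_on 2 D1 ?U"
    using smooth_on_Suc_blinfun[OF smooth_on_Fhat[of "Suc 2"]] by blast
  obtain D2 where D2: "\<And>x. x \<in> ?U \<Longrightarrow> (D1 has_derivative blinfun_apply (D2 x)) (at x within ?U)"
      and s2: "smooth_on 1 D2 ?U"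
    using smooth_on_Suc_blinfun[OF s1[unfolded Suc_1[symmetric]]] by blast
  obtain D3 where D3: "\<And>x. x \<in> ?U \<Longrightarrow> (D2 has_derivative blinfun_apply (D3 x)) (at x within ?U)"
      and s3: "smooth_on 0 D3 ?U"
    using smooth_on_Suc_blinfun[OF s2[unfolded One_nat_def]] by blast
  have diag: "D1 x h = Fhat1 x h" "D2 x h h = Fhat2 x h" "D3 x h h h = Fhat3 x h"
    if "x \<in> ?U" "h \<in> ?V" for x h
    using diagonal_derivatives_eq[OF openin_Fhat_dom subspace_amb_space that D1 D2 D3
        Fhat_line_derivatives[OF _ that(2), of x]] by simp_all
  show ?thesis
    unfolding sc_barrier_def
  proof (intro conjI)
    show "Km_linf \<subseteq> ?V" by (auto simp: Km_linf_iff amb_space_def)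
    show "\<exists>D1 D2 D3.
        (\<forall>x\<in>?U. (Fhat has_derivative blinfun_apply (D1 x)) (at x within ?U) \<and>
          (D1 has_derivative blinfun_apply (D2 x)) (at x within ?U) \<and>
          (D2 has_derivative blinfun_apply (D3 x)) (at x within ?U)) \<and>
        continuous_on ?U D3 \<and>
        (\<forall>x\<in>?U. \<forall>h\<in>?V. \<bar>D3 x h h h\<bar> \<le> 2 * (D2 x h h) powr (3/2) \<and>
           (D1 x h)\<^sup>2 \<le> real (CARD('n) * (CARD('k) + 1)) * D2 x h h)"
    proof (intro exI conjI ballI)
      show "continuous_on ?U D3" using s3 by simp
      fix x h assume x: "x \<in> ?U" and h: "h \<in> ?V"
      show "\<bar>D3 x h h h\<bar> \<le> 2 * (D2 x h h) powr (3/2)"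
        and "(D1 x h)\<^sup>2 \<le> real (CARD('n) * (CARD('k) + 1)) * D2 x h h"
        unfolding diag[OF x h] by (rule Fhat_bounds[OF x h])+
    qed (use D1 D2 D3 in blast)+
  qed (use subspace_amb_space closed_Km_linf convex_Km_linf Fhat_dom_eq_interior Fhat_dom_nonempty
      convex_on_Fhat Fhat_barrier in blast)+
qed

end
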